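(* There exists a constant $c > 0$ such that there are infinitely many $4$-regular $4$-connected graphs, each containing exactly $c$ Hamiltonian cycles.
   Context: Graphs are finite. A graph is $4$-regular if every vertex has degree $4$, and $4$-connected if it has more than $4$ vertices and remains connected after deleting any set of at most $3$ vertices. A Hamiltonian cycle is a cycle passing through every vertex of the graph exactly once. *)

theory Defs
  imports "Graph_Theory.Graph_Theory"
begin

text \<open>
  A finite simple graph is a \<^locale>\<open>pair_graph\<close>: a finite vertex set with a symmetric, irreflexive
  arc relation, where an undirected edge \<open>{u, v}\<close> is represented by the two arcs \<open>(u, v)\<close> and
  \<open>(v, u)\<close>. Hence the degree of a vertex is its out-degree (which equals its in-degree).
\<close>

definition regular :: "nat \<Rightarrow> 'a pair_pre_digraph \<Rightarrow> bool" where
  "regular k G \<longleftrightarrow> (\<forall>v \<in> pverts G. out_degree (with_proj G) v = k)"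

definition vertex_connected :: "nat \<Rightarrow> 'a pair_pre_digraph \<Rightarrow> bool" where
  "vertex_connected k G \<longleftrightarrow>
     k < card (pverts G) \<and>
     (\<forall>S \<subseteq> pverts G. card S < k \<longrightarrow> connected (with_proj G \<restriction> (pverts G - S)))"

text \<open>
  The library's \<^const>\<open>pre_digraph.cycle\<close> is a list of arcs with a chosen starting vertex and
  direction, and it admits \<open>[(u, v), (v, u)]\<close>. A cycle of an undirected graph is a subgraph with at
  least three edges, so we forget start and direction by passing to the set of undirected edges;
  otherwise each Hamiltonian cycle on \<open>n\<close> vertices would be counted \<open>2 * n\<close> times.
  In a closed walk every vertex is the tail of some arc, so \<open>fst ` set p\<close> is its vertex set.
\<close>

definition hamiltonian_cycles :: "'a pair_pre_digraph \<Rightarrow> 'a set set set" where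
  "hamiltonian_cycles G =
     {(\<lambda>(u, v). {u, v}) ` set p | p.
        pre_digraph.cycle (with_proj G) p \<and> 3 \<le> length p \<and> fst ` set p = pverts G}"

end

theory Submission
  imports Defs
begin

text \<open>
  In a long strip of vertices in which \<open>q\<close> is adjacent to \<open>q + 1\<close> and \<open>q + 5\<close>, suppose that a
  Hamiltonian cycle uses both or none of the two lower edges at each vertex near the left end,
  alternating with the parity of the vertex. Then at every further vertex the two lower edges are
  again both used or both unused, and this forces the two upper edges: the cycle is determined on the
  whole strip. The left end is attached to a fixed gadget which forces exactly this pattern. The gadget
  is built from copies of \<open>K\<^bsub>4,3\<^esub>\<close>, which a Hamiltonian cycle must enter and leave
  exactly once. Three such copies in a row, joined by double edges, form a rung, and at each end of a
  rung exactly one of the two outer edges is used. Two rungs and a further copy force their outer edges.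

  So a Hamiltonian cycle is determined by its edges among boundedly many vertices, the number of
  Hamiltonian cycles is bounded independently of the length of the strip, and by the pigeonhole
  principle some positive number occurs for infinitely many lengths.
\<close>

section \<open>Hamiltonian cycles as cyclic enumerations\<close>

lemma pcas_imp_rotate1:
  assumes "pcas u p v" "p \<noteq> []"
  shows "fst (hd p) = u" "map snd p = tl (map fst p) @ [v]"
  using assms
proof (induction p arbitrary: u)
  case (Cons e p)
  { case 1 then show ?case using Cons by simp }
  { case 2 then show ?case using Cons by (cases p) auto }
qed auto

lemma pcas_zip_rotate1:
  assumes "pcas u p u" "p \<noteq> []"
  shows "p = zip (map fst p) (rotate1 (map fst p))"
proof -
  have "map snd p = rotate1 (map fst p)"
    using pcas_imp_rotate1[OF assms] assms(2) by (cases p) auto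
  then show ?thesis by (metis zip_map_fst_snd)
qed

lemma pcas_zip:
  assumes "length vs = length ws" "vs \<noteq> []" "ws = tl vs @ [z]"
  shows "pcas (hd vs) (zip vs ws) z"
  using assms
proof (induction vs arbitrary: ws)
  case (Cons v vs)
  then show ?case by (cases vs) auto
qed auto

lemma tl_pawalk_verts: "pcas u p v \<Longrightarrow> tl (pawalk_verts u p) = map snd p"
proof (induction p arbitrary: u)
  case (Cons e p)
  then show ?case by (cases p) auto
qed auto

text \<open>Repeating the cyclic list of vertices with period \<open>n\<close> gives an enumeration
  by all naturals, in which the arc from the last vertex back to the first is an ordinary successor
  step.\<close>

lemma hamiltonian_cyclesE:
  assumes "C \<in> hamiltonian_cycles G"
  obtains n :: nat and g :: "nat \<Rightarrow> 'a"
  where "3 \<le> n" "\<forall>i j. g i = g j \<longleftrightarrow> i mod n = j mod n" "range g = pverts G"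
    "C = range (\<lambda>i. {g i, g (Suc i)})" "\<forall>i. (g i, g (Suc i)) \<in> parcs G"
proof -
  obtain p where p: "C = (\<lambda>(u, v). {u, v}) ` set p" "pre_digraph.cycle (with_proj G) p"
    "3 \<le> length p" "fst ` set p = pverts G"
    using assms unfolding hamiltonian_cycles_def by blast
  obtain u where u: "set p \<subseteq> parcs G" "pcas u p u" "distinct (map snd p)" "p \<noteq> []"
    using p(2) unfolding pre_digraph.cycle_def pre_digraph.awalk_def
    by (auto simp: cas_with_proj_eq awalk_verts_with_proj_eq tl_pawalk_verts)
  define vs where "vs = map fst p"
  define n where "n = length vs"
  have pz: "p = zip vs (rotate1 vs)" using pcas_zip_rotate1[OF u(2,4)] by (simp add: vs_def)
  have len: "length p = n" by (simp add: n_def vs_def)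
  have n3: "3 \<le> n" using p(3) len by simp
  have "map snd p = rotate1 vs"
    by (subst pz) (simp add: map_snd_zip)
  then have dist: "distinct vs" using u(3) by simp
  define g where "g = (\<lambda>i. vs ! (i mod n))"
  have nth: "p ! i = (g i, g (Suc i))" if "i < n" for i
  proof -
    have "p ! i = (vs ! i, rotate1 vs ! i)"
      using that len by (subst pz) (simp add: n_def)
    also have "rotate1 vs ! i = g (Suc i)"
      using that by (simp add: g_def nth_rotate1 n_def)
    finally show ?thesis using that by (simp add: g_def)
  qed
  have gmod: "g (i mod n) = g i" "g (Suc (i mod n)) = g (Suc i)" for i
    by (simp_all add: g_def mod_Suc_eq)
  have lt: "i mod n < n" for i using n3 by simp
  have arcs: "(g i, g (Suc i)) \<in> set p" for i
    using nth[OF lt[of i]] nth_mem[of "i mod n" p] lt[of i] len by (simp add: gmod)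
  show ?thesis
  proof
    show "3 \<le> n" by (rule n3)
    show "\<forall>i j. g i = g j \<longleftrightarrow> i mod n = j mod n"
      using nth_eq_iff_index_eq[OF dist] lt by (simp add: g_def n_def)
    have setp: "set p = range (\<lambda>i. (g i, g (Suc i)))"
    proof
      show "set p \<subseteq> range (\<lambda>i. (g i, g (Suc i)))"
        using nth len by (auto simp: in_set_conv_nth)
    qed (use arcs in auto)
    show "range g = pverts G" unfolding p(4)[symmetric] setp by (auto simp: image_image)
    show "C = range (\<lambda>i. {g i, g (Suc i)})" unfolding p(1) setp by (auto simp: image_image)
    show "\<forall>i. (g i, g (Suc i)) \<in> parcs G" using arcs u(1) by auto
  qed
qed

lemma hamiltonian_cyclesI:
  assumes "distinct vs" "3 \<le> length vs" "set vs = pverts G"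
    "set (zip vs (rotate1 vs)) \<subseteq> parcs G"
  shows "(\<lambda>(u, v). {u, v}) ` set (zip vs (rotate1 vs)) \<in> hamiltonian_cycles G"
proof -
  let ?p = "zip vs (rotate1 vs)"
  have ne: "vs \<noteq> []" using assms(2) by auto
  have rot: "rotate1 vs = tl vs @ [hd vs]" using ne by (cases vs) auto
  have fst: "map fst ?p = vs" and snd: "map snd ?p = rotate1 vs" by simp_all
  have pc: "pcas (hd vs) ?p (hd vs)" using pcas_zip[of vs "rotate1 vs"] ne rot by simp
  have "distinct (tl (pawalk_verts (hd vs) ?p))"
    unfolding tl_pawalk_verts[OF pc] snd using assms(1) by simp
  moreover have "hd vs \<in> pverts G" unfolding assms(3)[symmetric] by (rule hd_in_set[OF ne])
  moreover have "?p \<noteq> []" using ne assms(2) by (cases vs) auto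
  ultimately have "pre_digraph.cycle (with_proj G) ?p"
    unfolding pre_digraph.cycle_def pre_digraph.awalk_def cas_with_proj_eq awalk_verts_with_proj_eq
      with_proj_simps using assms(4) pc by blast
  moreover have "fst ` set ?p = pverts G" using fst assms(3) by (metis set_map)
  moreover have "3 \<le> length ?p" using assms(2) by simp
  ultimately show ?thesis unfolding hamiltonian_cycles_def by blast
qed

lemma hamiltonian_cycle_degree:
  assumes "C \<in> hamiltonian_cycles G" "v \<in> pverts G"
  shows "card {w. {v, w} \<in> C} = 2"
proof -
  obtain n g where g: "3 \<le> n" "\<forall>i j. g i = g j \<longleftrightarrow> i mod n = j mod n" "range g = pverts G"
    "C = range (\<lambda>i. {g i, g (Suc i)})" "\<forall>i. (g i, g (Suc i)) \<in> parcs G"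
    by (rule hamiltonian_cyclesE[OF assms(1)])
  obtain i where i: "v = g i" using assms(2) g(3) by auto
  have Suc_cong: "g (Suc j) = g (Suc k)" if "g j = g k" for j k
  proof -
    have "j mod n = k mod n" using that g(2) by simp
    then have "Suc j mod n = Suc k mod n" by (metis mod_Suc_eq)
    then show ?thesis using g(2) by simp
  qed
  \<comment> \<open>This index stands for the predecessor of \<open>i\<close> modulo
    \<open>n\<close> and avoids truncated subtraction.\<close>
  define h where "h = i + (n - 1)"
  have h: "g (Suc h) = g i" using g(1,2) by (simp add: h_def)
  have pred: "g j = g h" if "g (Suc j) = g i" for j
  proof -
    have "Suc j mod n = Suc h mod n" using that h g(2) by simp
    then have "(Suc j + (n - 1)) mod n = (Suc h + (n - 1)) mod n" by (metis mod_add_left_eq)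
    then have "(j + n) mod n = (h + n) mod n" using g(1) by simp
    then show ?thesis using g(2) by simp
  qed
  have "{w. {v, w} \<in> C} = {g (Suc i), g h}"
  proof (intro set_eqI iffI; clarsimp)
    fix w assume "{v, w} \<in> C" "w \<noteq> g h"
    then obtain j where "{g i, w} = {g j, g (Suc j)}" unfolding g(4) i by blast
    then consider "g i = g j" "w = g (Suc j)" | "g (Suc j) = g i" "w = g j"
      unfolding doubleton_eq_iff by metis
    then show "w = g (Suc i)"
    proof cases
      case 1 then show ?thesis using Suc_cong[of j i] by simp
    next
      case 2 then show ?thesis using pred[of j] \<open>w \<noteq> g h\<close> by simp
    qed
  next
    fix w assume "w = g (Suc i) \<or> w = g h"
    then show "{v, w} \<in> C"
    proof
      assume "w = g h"
      then have "{v, w} = {g h, g (Suc h)}" unfolding h i by blast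
      then show ?thesis unfolding g(4) by blast
    qed (unfold g(4) i, blast)
  qed
  moreover have "g (Suc i) \<noteq> g h"
  proof
    assume "g (Suc i) = g h"
    then have "g (Suc (Suc i)) = g i" using h Suc_cong[of "Suc i" h] by simp
    \<comment> \<open>Successor and predecessor coincide only if two steps close up, which
      \<open>3 \<le> n\<close> excludes.\<close>
    then have "(i + 2) mod n = i mod n" using g(2) by simp
    then have "n dvd 2" using mod_eq_dvd_iff_nat[of i "i + 2" n] by simp
    then show False using g(1) dvd_imp_le[of n 2] by simp
  qed
  ultimately show ?thesis by simp
qed

lemma hamiltonian_cycle_arcs:
  assumes "C \<in> hamiltonian_cycles G" "e \<in> C"
  obtains u v where "e = {u, v}" "(u, v) \<in> parcs G"
proof -
  obtain n g where "3 \<le> n" "\<forall>i j. g i = g j \<longleftrightarrow> i mod n = j mod n" "range g = pverts G"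
    and g: "C = range (\<lambda>i. {g i, g (Suc i)})" "\<forall>i. (g i, g (Suc i)) \<in> parcs G"
    by (rule hamiltonian_cyclesE[OF assms(1)])
  then show ?thesis using that assms(2) by auto
qed

text \<open>Following the cycle from \<open>u\<close>, one eventually reaches \<open>v\<close>, so
  some step leaves \<open>X\<close>.\<close>

lemma hamiltonian_cycle_cut:
  assumes "C \<in> hamiltonian_cycles G" "u \<in> X" "u \<in> pverts G" "v \<in> pverts G" "v \<notin> X"
  obtains x y where "x \<in> X" "y \<notin> X" "(x, y) \<in> parcs G" "{x, y} \<in> C"
proof -
  obtain n g where g: "3 \<le> n" "\<forall>i j. g i = g j \<longleftrightarrow> i mod n = j mod n" "range g = pverts G"
    "C = range (\<lambda>i. {g i, g (Suc i)})" "\<forall>i. (g i, g (Suc i)) \<in> parcs G"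
    by (rule hamiltonian_cyclesE[OF assms(1)])
  obtain i j where ij: "u = g i" "v = g j" using assms(3,4) unfolding g(3)[symmetric] by blast
  have "\<exists>k. g k \<in> X \<and> g (Suc k) \<notin> X"
  proof (rule ccontr)
    assume *: "\<not> ?thesis"
    have "g (i + k) \<in> X" for k
      by (induction k) (use * assms(2) ij in auto)
    have "\<exists>k. (i + k) mod n = j mod n"
    proof
      \<comment> \<open>The number of steps is chosen so that the index becomes
        \<open>j + i * n\<close>.\<close>
      show "(i + (j + i * (n - 1))) mod n = j mod n"
      proof -
        have "i + (j + i * (n - 1)) = j + i * n" using g(1) by (cases n) auto
        then show ?thesis by (simp only: mod_mult_self1)
      qed
    qed
    then obtain k where "(i + k) mod n = j mod n" by blast
    then have "g (i + k) = g j" using g(2) by simp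
    moreover have "g (i + k) \<in> X" using \<open>\<And>k. g (i + k) \<in> X\<close> .
    ultimately have "g j \<in> X" by simp
    then show False using assms ij by simp
  qed
  then show ?thesis using that g(4,5) by blast
qed

section \<open>The graphs\<close>

text \<open>
  The vertices below \<open>98\<close> form 14 copies of \<open>K\<^bsub>4,3\<^esub>\<close> (\<open>blobs\<close>): blob \<open>j\<close> has the larger side
  \<open>{7j, \<dots>, 7j + 3}\<close>, each vertex of which has one edge leaving the blob, and the smaller side
  \<open>{7j + 4, 7j + 5, 7j + 6}\<close>. The list below gives the leaving edges. Blobs \<open>0, \<dots>, 6\<close> form a piece:
  the rungs \<open>0 = 1 = 2\<close> and \<open>5 = 4 = 3\<close> (with double edges) are joined by the edges \<open>0 - 5\<close> and
  \<open>2 - 3\<close>, and blob \<open>6\<close> is attached to \<open>2\<close> and \<open>3\<close>. Blobs \<open>7, \<dots>, 13\<close> form a second such piece.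
\<close>

definition links :: "(nat \<times> nat) list" where
  "links =
    [(1, 36), (2, 7), (3, 8), (9, 14), (10, 15), (37, 28), (38, 29), (30, 21), (31, 22),
     (16, 23), (17, 42), (24, 43), (0, 100), (35, 98), (45, 99),
     (50, 85), (51, 56), (52, 57), (58, 63), (59, 64), (86, 77), (87, 78), (79, 70), (80, 71),
     (65, 72), (66, 91), (73, 92), (49, 102), (84, 98), (94, 99), (44, 93)]"

text \<open>Meant for the larger sides of the blobs, where it is the other end of the unique leaving
  edge. The vertices 98 and 99 lie on two links each, so there the lookup only finds the
  first.\<close>

definition partner :: "nat \<Rightarrow> nat" where
  "partner v = the (map_of (links @ map prod.swap links) v)"

text \<open>Vertex 98 receives one outer rung edge from each piece. Both turn out to be forced,
  which blocks its edges to 101 and 103.\<close>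

definition cap_nbrs :: "nat \<Rightarrow> nat list" where
  "cap_nbrs v =
    (if v = 98 then [35, 84, 101, 103]
     else let b = v - v mod 7 in
       if v mod 7 < 4 then [b + 4, b + 5, b + 6, partner v] else [b, b + 1, b + 2, b + 3])"

text \<open>
  The vertices from \<open>99\<close> on form the strip, in which \<open>q\<close> is joined to \<open>q + 1\<close> and \<open>q + 5\<close>;
  the ends of the strip are closed up to make all degrees four.
\<close>

definition lower :: "nat \<Rightarrow> nat list" where
  "lower q =
    (if q = 99 then [45, 94] else if q = 100 then [99, 0] else if q = 101 then [100, 98]
     else if q = 102 then [101, 49] else if q = 103 then [102, 98] else [q - 1, q - 5])"

definition upper :: "nat \<Rightarrow> nat \<Rightarrow> nat list" where
  "upper N q =
    (if q + 5 \<le> N then [q + 1, q + 5] else if q + 4 = N then [q + 1, q + 4]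
     else if q + 2 \<le> N then [q + 1, q + 2]
     else if q + 1 = N then [q + 1, q - 2] else [q - 2, q - 4])"

definition nbrs :: "nat \<Rightarrow> nat \<Rightarrow> nat list" where
  "nbrs N v = (if v < 99 then cap_nbrs v else lower v @ upper N v)"

definition chain_graph :: "nat \<Rightarrow> nat pair_pre_digraph" where
  "chain_graph N = \<lparr>pverts = {..N}, parcs = {(u, v). u \<le> N \<and> v \<in> set (nbrs N u)}\<rparr>"

lemma partner_simps:
  "partner 0 = 100" "partner (Suc 0) = 36" "partner 2 = 7" "partner 3 = 8" "partner 7 = 2"
  "partner 8 = 3" "partner 9 = 14" "partner 10 = 15" "partner 14 = 9" "partner 15 = 10"
  "partner 16 = 23" "partner 17 = 42" "partner 21 = 30" "partner 22 = 31" "partner 23 = 16"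
  "partner 24 = 43" "partner 28 = 37" "partner 29 = 38" "partner 30 = 21" "partner 31 = 22"
  "partner 35 = 98" "partner 36 = 1" "partner 37 = 28" "partner 38 = 29" "partner 42 = 17"
  "partner 43 = 24" "partner 44 = 93" "partner 45 = 99" "partner 49 = 102" "partner 50 = 85"
  "partner 51 = 56" "partner 52 = 57" "partner 56 = 51" "partner 57 = 52" "partner 58 = 63"
  "partner 59 = 64" "partner 63 = 58" "partner 64 = 59" "partner 65 = 72" "partner 66 = 91"
  "partner 70 = 79" "partner 71 = 80" "partner 72 = 65" "partner 73 = 92" "partner 77 = 86"
  "partner 78 = 87" "partner 79 = 70" "partner 80 = 71" "partner 84 = 98" "partner 85 = 50"
  "partner 86 = 77" "partner 87 = 78" "partner 91 = 66" "partner 92 = 73" "partner 93 = 44"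
  "partner 94 = 99"
  by (simp_all add: partner_def links_def)

lemma cap_nbrs_simps [simp]:
  "cap_nbrs 0 = [4,5,6,100]" "cap_nbrs (Suc 0) = [4,5,6,36]" "cap_nbrs 2 = [4,5,6,7]"
  "cap_nbrs 3 = [4,5,6,8]" "cap_nbrs 4 = [0,1,2,3]" "cap_nbrs 5 = [0,1,2,3]"
  "cap_nbrs 6 = [0,1,2,3]" "cap_nbrs 7 = [11,12,13,2]" "cap_nbrs 8 = [11,12,13,3]"
  "cap_nbrs 9 = [11,12,13,14]" "cap_nbrs 10 = [11,12,13,15]" "cap_nbrs 11 = [7,8,9,10]"
  "cap_nbrs 12 = [7,8,9,10]" "cap_nbrs 13 = [7,8,9,10]" "cap_nbrs 14 = [18,19,20,9]"
  "cap_nbrs 15 = [18,19,20,10]" "cap_nbrs 16 = [18,19,20,23]" "cap_nbrs 17 = [18,19,20,42]"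
  "cap_nbrs 18 = [14,15,16,17]" "cap_nbrs 19 = [14,15,16,17]" "cap_nbrs 20 = [14,15,16,17]"
  "cap_nbrs 21 = [25,26,27,30]" "cap_nbrs 22 = [25,26,27,31]" "cap_nbrs 23 = [25,26,27,16]"
  "cap_nbrs 24 = [25,26,27,43]" "cap_nbrs 25 = [21,22,23,24]" "cap_nbrs 26 = [21,22,23,24]"
  "cap_nbrs 27 = [21,22,23,24]" "cap_nbrs 28 = [32,33,34,37]" "cap_nbrs 29 = [32,33,34,38]"
  "cap_nbrs 30 = [32,33,34,21]" "cap_nbrs 31 = [32,33,34,22]" "cap_nbrs 32 = [28,29,30,31]"
  "cap_nbrs 33 = [28,29,30,31]" "cap_nbrs 34 = [28,29,30,31]" "cap_nbrs 35 = [39,40,41,98]"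
  "cap_nbrs 36 = [39,40,41,1]" "cap_nbrs 37 = [39,40,41,28]" "cap_nbrs 38 = [39,40,41,29]"
  "cap_nbrs 39 = [35,36,37,38]" "cap_nbrs 40 = [35,36,37,38]" "cap_nbrs 41 = [35,36,37,38]"
  "cap_nbrs 42 = [46,47,48,17]" "cap_nbrs 43 = [46,47,48,24]" "cap_nbrs 44 = [46,47,48,93]"
  "cap_nbrs 45 = [46,47,48,99]" "cap_nbrs 46 = [42,43,44,45]" "cap_nbrs 47 = [42,43,44,45]"
  "cap_nbrs 48 = [42,43,44,45]" "cap_nbrs 49 = [53,54,55,102]" "cap_nbrs 50 = [53,54,55,85]"
  "cap_nbrs 51 = [53,54,55,56]" "cap_nbrs 52 = [53,54,55,57]" "cap_nbrs 53 = [49,50,51,52]"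
  "cap_nbrs 54 = [49,50,51,52]" "cap_nbrs 55 = [49,50,51,52]" "cap_nbrs 56 = [60,61,62,51]"
  "cap_nbrs 57 = [60,61,62,52]" "cap_nbrs 58 = [60,61,62,63]" "cap_nbrs 59 = [60,61,62,64]"
  "cap_nbrs 60 = [56,57,58,59]" "cap_nbrs 61 = [56,57,58,59]" "cap_nbrs 62 = [56,57,58,59]"
  "cap_nbrs 63 = [67,68,69,58]" "cap_nbrs 64 = [67,68,69,59]" "cap_nbrs 65 = [67,68,69,72]"
  "cap_nbrs 66 = [67,68,69,91]" "cap_nbrs 67 = [63,64,65,66]" "cap_nbrs 68 = [63,64,65,66]"
  "cap_nbrs 69 = [63,64,65,66]" "cap_nbrs 70 = [74,75,76,79]" "cap_nbrs 71 = [74,75,76,80]"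
  "cap_nbrs 72 = [74,75,76,65]" "cap_nbrs 73 = [74,75,76,92]" "cap_nbrs 74 = [70,71,72,73]"
  "cap_nbrs 75 = [70,71,72,73]" "cap_nbrs 76 = [70,71,72,73]" "cap_nbrs 77 = [81,82,83,86]"
  "cap_nbrs 78 = [81,82,83,87]" "cap_nbrs 79 = [81,82,83,70]" "cap_nbrs 80 = [81,82,83,71]"
  "cap_nbrs 81 = [77,78,79,80]" "cap_nbrs 82 = [77,78,79,80]" "cap_nbrs 83 = [77,78,79,80]"
  "cap_nbrs 84 = [88,89,90,98]" "cap_nbrs 85 = [88,89,90,50]" "cap_nbrs 86 = [88,89,90,77]"
  "cap_nbrs 87 = [88,89,90,78]" "cap_nbrs 88 = [84,85,86,87]" "cap_nbrs 89 = [84,85,86,87]"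
  "cap_nbrs 90 = [84,85,86,87]" "cap_nbrs 91 = [95,96,97,66]" "cap_nbrs 92 = [95,96,97,73]"
  "cap_nbrs 93 = [95,96,97,44]" "cap_nbrs 94 = [95,96,97,99]" "cap_nbrs 95 = [91,92,93,94]"
  "cap_nbrs 96 = [91,92,93,94]" "cap_nbrs 97 = [91,92,93,94]" "cap_nbrs 98 = [35,84,101,103]"
  by (simp_all add: cap_nbrs_def partner_simps)

lemma upt_0_99: "[0..<99] = [0,1,2,3,4,5,6,7,8,9,10,11,12,13,14,15,16,17,18,19,20,21,22,23,24,25,26,27,28,29,30,31,32,33,34,35,36,37,38,39,40,41,42,43,44,45,46,47,48,49,50,51,52,53,54,55,56,57,58,59,60,61,62,63,64,65,66,67,68,69,70,71,72,73,74,75,76,77,78,79,80,81,82,83,84,85,86,87,88,89,90,91,92,93,94,95,96,97,98]"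
proof -
  have "[0..<99] = 0 # 1 # [2..<99::nat]" by (simp add: upt_conv_Cons numeral_2_eq_2)
  also have "[2..<99::nat] = [2,3,4,5,6,7,8,9,10,11,12,13,14,15,16,17,18,19,20,21,22,23,24,25,26,27,28,29,30,31,32,33,34,35,36,37,38,39,40,41,42,43,44,45,46,47,48,49,50,51,52,53,54,55,56,57,58,59,60,61,62,63,64,65,66,67,68,69,70,71,72,73,74,75,76,77,78,79,80,81,82,83,84,85,86,87,88,89,90,91,92,93,94,95,96,97,98]" by simp
  finally show ?thesis .
qed

text \<open>Degrees, symmetry and absence of loops in the fixed part are a finite evaluation. The
  bound 103 records that the cap touches only the first five strip vertices.\<close>

lemma cap_check:
  "list_all (\<lambda>v. distinct (v # cap_nbrs v) \<and> length (cap_nbrs v) = 4 \<and>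
     list_all (\<lambda>w. w \<le> 103 \<and> (if w < 99 then v \<in> set (cap_nbrs w) else v \<in> set (lower w))) (cap_nbrs v))
   [0..<99]"
  unfolding upt_0_99 by (simp add: lower_def)

lemma nbrs_cap:
  assumes "v < 99"
  shows "distinct (v # cap_nbrs v)" "length (cap_nbrs v) = 4"
    "\<forall>w \<in> set (cap_nbrs v). w \<le> 103 \<and> (if w < 99 then v \<in> set (cap_nbrs w) else v \<in> set (lower w))"
proof -
  have "v \<in> set [0..<99]" using assms by simp
  from cap_check[unfolded list_all_iff, rule_format, OF this]
  show "distinct (v # cap_nbrs v)" "length (cap_nbrs v) = 4"
    "\<forall>w \<in> set (cap_nbrs v). w \<le> 103 \<and> (if w < 99 then v \<in> set (cap_nbrs w) else v \<in> set (lower w))"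
    by simp_all
qed

lemma lower_iff: "99 \<le> v \<Longrightarrow> v \<in> set (lower w) \<longleftrightarrow> w = v + 1 \<or> w = v + 5" if "99 \<le> w"
  using that by (auto simp: lower_def)

lemma lower_cap: "99 \<le> w \<Longrightarrow> v \<in> set (lower w) \<Longrightarrow> v < 99 \<Longrightarrow> w \<in> set (cap_nbrs v)"
  by (auto simp: lower_def split: if_splits)

text \<open>At the right end, \<open>N\<close> lacks two upper neighbours and each of the four
  vertices before it lacks one. The three extra edges listed here supply these six ends, and the
  description is visibly symmetric.\<close>

lemma upper_iff:
  assumes "108 \<le> N" "w \<le> N"
  shows "v \<in> set (upper N w) \<longleftrightarrow> v \<le> N \<and> (v = w + 1 \<or> v = w + 5) \<or>
    (v, w) \<in> {(N, N - 2), (N - 2, N), (N, N - 4), (N - 4, N), (N - 1, N - 3), (N - 3, N - 1)}"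
proof -
  consider "w + 5 \<le> N" | "N = w + 4" | "N = w + 3" | "N = w + 2" | "N = w + 1" | "N = w"
    using assms(2) by atomize_elim presburger
  then show ?thesis using assms(1) by cases (auto simp: upper_def)
qed

lemma nbrs_strip_iff:
  assumes "108 \<le> N" "99 \<le> v" "99 \<le> w" "w \<le> N"
  shows "v \<in> set (nbrs N w) \<longleftrightarrow> w = v + 1 \<or> w = v + 5 \<or> v \<le> N \<and> (v = w + 1 \<or> v = w + 5) \<or>
    (v, w) \<in> {(N, N - 2), (N - 2, N), (N, N - 4), (N - 4, N), (N - 1, N - 3), (N - 3, N - 1)}"
  unfolding nbrs_def using assms(3) by (simp add: lower_iff[OF assms(3,2)] upper_iff[OF assms(1,4)])

lemma nbrs_strip:
  assumes "108 \<le> N" "99 \<le> v" "v \<le> N"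
  shows "distinct (v # nbrs N v)" "length (nbrs N v) = 4"
    "\<forall>w \<in> set (nbrs N v). w \<le> N \<and> v \<in> set (nbrs N w)"
proof -
  show "distinct (v # nbrs N v)"
  proof -
    consider "v = 99" | "v = 100" | "v = 101" | "v = 102" | "v = 103"
      | k where "v = k + 104" "v + 5 \<le> N" | k where "v = k + 104" "N = v + 4"
      | k where "v = k + 104" "N = v + 3" | k where "v = k + 104" "N = v + 2"
      | k where "v = k + 104" "N = v + 1" | k where "v = k + 104" "N = v"
      using assms by atomize_elim presburger
    then show ?thesis
      using assms(1) by cases (simp_all add: nbrs_def lower_def upper_def)
  qed
  have "length (lower v) = 2" "length (upper N v) = 2" unfolding lower_def upper_def by simp_all
  then show "length (nbrs N v) = 4" using assms(2) by (simp add: nbrs_def)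
  show "\<forall>w \<in> set (nbrs N v). w \<le> N \<and> v \<in> set (nbrs N w)"
  proof
    fix w assume w: "w \<in> set (nbrs N v)"
    show "w \<le> N \<and> v \<in> set (nbrs N w)"
    proof (cases "w < 99")
      case True
      have "w \<notin> set (upper N v)" using True assms by (auto simp: upper_iff)
      then have "v \<in> set (cap_nbrs w)" using w True assms(2) lower_cap[of v w] by (simp add: nbrs_def)
      then show ?thesis using True assms(1) by (simp add: nbrs_def)
    next
      case False
      then have "99 \<le> w" by simp
      note * = nbrs_strip_iff[OF assms(1) this assms(2,3)] nbrs_strip_iff[OF assms(1,2) this]
      have "w \<le> N" using w assms(3) unfolding *(1) by auto
      then show ?thesis using w assms(3) unfolding *(1) *(2)[OF \<open>w \<le> N\<close>] by blast
    qed
  qed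
qed

lemma nbrs:
  assumes "108 \<le> N" "v \<le> N"
  shows "distinct (nbrs N v)" "length (nbrs N v) = 4" "v \<notin> set (nbrs N v)"
    "w \<in> set (nbrs N v) \<Longrightarrow> w \<le> N" "w \<in> set (nbrs N v) \<Longrightarrow> v \<in> set (nbrs N w)"
proof -
  have "distinct (v # nbrs N v) \<and> length (nbrs N v) = 4 \<and>
    (\<forall>w \<in> set (nbrs N v). w \<le> N \<and> v \<in> set (nbrs N w))"
  proof (cases "v < 99")
    case True
    have "w \<le> N \<and> v \<in> set (nbrs N w)" if "w \<in> set (cap_nbrs v)" for w
      using bspec[OF nbrs_cap(3)[OF True] that] assms(1) by (auto simp: nbrs_def)
    moreover have "nbrs N v = cap_nbrs v" using True by (simp add: nbrs_def)
    ultimately show ?thesis using nbrs_cap(1,2)[OF True] by auto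
  next
    case False
    then have "99 \<le> v" by simp
    note * = nbrs_strip[OF assms(1) this assms(2)]
    show ?thesis by (intro conjI *)
  qed
  then show "distinct (nbrs N v)" "length (nbrs N v) = 4" "v \<notin> set (nbrs N v)"
    "w \<in> set (nbrs N v) \<Longrightarrow> w \<le> N" "w \<in> set (nbrs N v) \<Longrightarrow> v \<in> set (nbrs N w)"
    unfolding distinct.simps by blast+
qed

section \<open>The graphs are simple and 4-regular\<close>

lemma pverts_graph [simp]: "pverts (chain_graph N) = {..N}"
  by (simp add: chain_graph_def)

lemma parcs_graph [simp]: "(u, v) \<in> parcs (chain_graph N) \<longleftrightarrow> u \<le> N \<and> v \<in> set (nbrs N u)"
  by (simp add: chain_graph_def)

lemma sym_parcs_graph: "108 \<le> N \<Longrightarrow> sym (parcs (chain_graph N))"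
  by (rule symI) (metis nbrs(4,5) parcs_graph)

lemma pair_graph_graph:
  assumes "108 \<le> N"
  shows "pair_graph (chain_graph N)"
proof -
  have "parcs (chain_graph N) \<subseteq> {..N} \<times> {..N}" using nbrs(4)[OF assms] by auto
  then have "finite (parcs (chain_graph N))" by (rule finite_subset) simp
  then show ?thesis
    using sym_parcs_graph[OF assms] nbrs(3,4)[OF assms]
    by unfold_locales (fastforce simp: symmetric_def)+
qed

lemma regular_graph:
  assumes "108 \<le> N"
  shows "regular 4 (chain_graph N)"
  unfolding regular_def
proof
  fix v assume v: "v \<in> pverts (chain_graph N)"
  have "out_arcs (with_proj (chain_graph N)) v = Pair v ` set (nbrs N v)"
    using v by (auto simp: out_arcs_def)
  also have "card \<dots> = card (set (nbrs N v))" by (rule card_image) (simp add: inj_on_def)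
  also have "\<dots> = 4" using nbrs(1,2)[OF assms, of v] v by (simp add: distinct_card)
  finally show "out_degree (with_proj (chain_graph N)) v = 4" by (simp add: out_degree_def)
qed

text \<open>The bound 113 is 108 + 5, so every strip vertex up to 108 still has its generic upper
  neighbours.\<close>

lemma nbrs_simps:
  assumes "113 \<le> N"
  shows
    "v < 99 \<Longrightarrow> nbrs N v = cap_nbrs v"
    "nbrs N 99 = [45,94,100,104]"
    "nbrs N 100 = [99,0,101,105]"
    "nbrs N 101 = [100,98,102,106]"
    "nbrs N 102 = [101,49,103,107]"
    "nbrs N 103 = [102,98,104,108]"
    "nbrs N 104 = [103,99,105,109]"
    "nbrs N 105 = [104,100,106,110]"
    "nbrs N 106 = [105,101,107,111]"
    "nbrs N 107 = [106,102,108,112]"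
    "nbrs N 108 = [107,103,109,113]"
  using assms by (simp_all add: nbrs_def lower_def upper_def)

section \<open>Robust vertex sets\<close>

text \<open>
  A set is robust if deleting at most three vertices of the ambient graph leaves the rest of the set
  within one component. A vertex with four paths to a robust set, disjoint except for their
  starting point, can be added to it.
\<close>

definition robust :: "('a \<times> 'a) set \<Rightarrow> 'a set \<Rightarrow> bool" where
  "robust E A \<longleftrightarrow>
     (\<forall>S. finite S \<longrightarrow> card S < 4 \<longrightarrow> (\<forall>u \<in> A - S. \<forall>v \<in> A - S. (u, v) \<in> (Restr E (- S))\<^sup>*))"

definition fan :: "('a \<times> 'a) set \<Rightarrow> 'a \<Rightarrow> 'a set \<Rightarrow> 'a list list \<Rightarrow> bool" where
  "fan E v A ps \<longleftrightarrow> length ps = 4 \<and> distinct (v # concat ps) \<and>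
     (\<forall>p \<in> set ps. p \<noteq> [] \<and> successively (\<lambda>x y. (x, y) \<in> E) (v # p) \<and> last p \<in> A)"

lemma successively_imp_rtrancl:
  assumes "successively (\<lambda>x y. (x, y) \<in> E) (v # p)" "set (v # p) \<inter> S = {}"
  shows "(v, last (v # p)) \<in> (Restr E (- S))\<^sup>*"
  using assms
proof (induction p arbitrary: v)
  case (Cons w p)
  then have "(v, w) \<in> Restr E (- S)" by auto
  moreover have "(w, last (w # p)) \<in> (Restr E (- S))\<^sup>*" using Cons by auto
  ultimately show ?case by (metis converse_rtrancl_into_rtrancl last.simps list.distinct(1))
qed simp

lemma length_le_filter_concat:
  "\<forall>p \<in> set ps. \<exists>x \<in> set p. P x \<Longrightarrow> length ps \<le> length (filter P (concat ps))"
proof (induction ps)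
  case (Cons p ps)
  then have "filter P p \<noteq> []" by (auto simp: filter_empty_conv)
  then have "1 \<le> length (filter P p)" by (cases "filter P p") auto
  then show ?case using Cons by auto
qed simp

text \<open>At most three deleted vertices cannot meet all four disjoint paths: otherwise the
  concatenation would contain four distinct deleted vertices.\<close>

lemma fan_avoids:
  assumes "fan E v A ps" "finite S" "card S < 4" "v \<notin> S"
  obtains a where "a \<in> A - S" "(v, a) \<in> (Restr E (- S))\<^sup>*"
proof -
  have "\<exists>p \<in> set ps. set p \<inter> S = {}"
  proof (rule ccontr)
    assume "\<not> ?thesis"
    then have "\<forall>p \<in> set ps. \<exists>x \<in> set p. x \<in> S" by blast
    from length_le_filter_concat[OF this]
    have "4 \<le> length (filter (\<lambda>x. x \<in> S) (concat ps))"
      using assms(1) by (simp add: fan_def)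
    also have "\<dots> = card (set (filter (\<lambda>x. x \<in> S) (concat ps)))"
      using assms(1) by (subst distinct_card) (auto simp: fan_def intro!: distinct_filter)
    also have "\<dots> \<le> card S" by (rule card_mono[OF assms(2)]) auto
    finally show False using assms(3) by simp
  qed
  then obtain p where p: "p \<in> set ps" "set p \<inter> S = {}" by blast
  have pp: "p \<noteq> []" "successively (\<lambda>x y. (x, y) \<in> E) (v # p)" "last p \<in> A"
    using assms(1) p(1) by (auto simp: fan_def)
  have "(v, last p) \<in> (Restr E (- S))\<^sup>*"
    using successively_imp_rtrancl[OF pp(2), of S] p assms(4) pp(1) by simp
  moreover have "last p \<in> A - S" using pp p(2) last_in_set[of p] by blast
  ultimately show ?thesis using that by blast
qed

lemma sym_Restr_rtrancl: "sym E \<Longrightarrow> sym ((Restr E X)\<^sup>*)"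
  by (intro sym_rtrancl) (auto simp: sym_def)

lemma robust_insert:
  assumes "sym E" "robust E B" "fan E v A ps" "A \<subseteq> B"
  shows "robust E (insert v B)"
  unfolding robust_def
proof (intro allI impI ballI)
  fix S u w assume S: "finite S" "card S < 4" and uw: "u \<in> insert v B - S" "w \<in> insert v B - S"
  let ?R = "(Restr E (- S))\<^sup>*"
  have *: "\<exists>b \<in> B - S. (x, b) \<in> ?R" if "x \<in> insert v B - S" for x
    using that fan_avoids[OF assms(3) S] assms(4) by (cases "x = v") blast+
  obtain b c where b: "b \<in> B - S" "(u, b) \<in> ?R" and c: "c \<in> B - S" "(w, c) \<in> ?R"
    using * uw by metis
  have "(b, c) \<in> ?R" using assms(2) S b(1) c(1) unfolding robust_def by blast
  moreover have "(c, w) \<in> ?R" using c(2) sym_Restr_rtrancl[OF assms(1)] by (metis symD)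
  ultimately show "(u, w) \<in> ?R" using b(2) by (meson rtrancl_trans)
qed

text \<open>This provides the first robust set. One of the four vertices survives the deletion and
  joins all of \<open>B\<close>; if \<open>a1\<close> survives, it is taken as this hub, so it is
  connected as well.\<close>

lemma robust_common_neighbours:
  assumes "sym E" "distinct [a1, a2, a3, a4]" "\<forall>a \<in> {a1, a2, a3, a4}. \<forall>b \<in> B. (a, b) \<in> E"
  shows "robust E (insert a1 B)"
  unfolding robust_def
proof (intro allI impI ballI)
  fix S u w assume S: "finite S" "card S < 4" and uw: "u \<in> insert a1 B - S" "w \<in> insert a1 B - S"
  let ?R = "(Restr E (- S))\<^sup>*"
  have "\<not> {a1, a2, a3, a4} \<subseteq> S"
  proof
    assume "{a1, a2, a3, a4} \<subseteq> S"
    then have "card {a1, a2, a3, a4} \<le> card S" using S(1) card_mono by blast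
    then show False using assms(2) S(2) by simp
  qed
  then obtain a where a: "a \<in> {a1, a2, a3, a4}" "a \<notin> S" "a1 \<notin> S \<longrightarrow> a = a1" by blast
  have *: "(x, a) \<in> ?R" if "x \<in> insert a1 B - S" for x
  proof (cases "x = a")
    case False
    then have "(a, x) \<in> E" using that a assms(3) by blast
    then have "(x, a) \<in> E" using assms(1) by (metis symD)
    then show ?thesis using that a(2) by (auto intro: r_into_rtrancl)
  qed simp
  have "(u, a) \<in> ?R" "(w, a) \<in> ?R" using uw * by blast+
  moreover from this(2) have "(a, w) \<in> ?R" by (rule symD[OF sym_Restr_rtrancl[OF assms(1)]])
  ultimately show "(u, w) \<in> ?R" by (meson rtrancl_trans)
qed

text \<open>Disjoint paths from the larger side of a K_{4,3} to \<open>A\<close> absorb the whole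
  blob. A vertex of the smaller side reaches all four paths directly; one of the larger side has its
  own path and reaches the other three through the three smaller-side vertices.\<close>

lemma robust_blob:
  assumes "sym E" "robust E A"
    and "distinct ([a1, a2, a3, a4, b1, b2, b3] @ pa @ pb @ pc @ pd)"
    and "\<forall>a \<in> {a1, a2, a3, a4}. \<forall>b \<in> {b1, b2, b3}. (a, b) \<in> E"
    and "\<forall>(a, p) \<in> {(a1, pa), (a2, pb), (a3, pc), (a4, pd)}.
           p \<noteq> [] \<and> successively (\<lambda>x y. (x, y) \<in> E) (a # p) \<and> last p \<in> A"
  shows "robust E ({a1, a2, a3, a4, b1, b2, b3} \<union> A)"
proof -
  have dist: "distinct [a1, a2, a3, a4, b1, b2, b3]" "distinct (pa @ pb @ pc @ pd)"
    "set [a1, a2, a3, a4, b1, b2, b3] \<inter> set (pa @ pb @ pc @ pd) = {}"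
    using assms(3) by (simp_all only: distinct_append)
  have E: "(x, y) \<in> E" "(y, x) \<in> E" if "x \<in> {a1, a2, a3, a4}" "y \<in> {b1, b2, b3}" for x y
    using assms(1,4) that by (meson symD)+
  have E': "(a1, b1) \<in> E" "(a1, b2) \<in> E" "(a1, b3) \<in> E" "(a2, b1) \<in> E" "(a2, b2) \<in> E" "(a2, b3) \<in> E"
    "(a3, b1) \<in> E" "(a3, b2) \<in> E" "(a3, b3) \<in> E" "(a4, b1) \<in> E" "(a4, b2) \<in> E" "(a4, b3) \<in> E"
    "(b1, a1) \<in> E" "(b2, a1) \<in> E" "(b3, a1) \<in> E" "(b1, a2) \<in> E" "(b2, a2) \<in> E" "(b3, a2) \<in> E"
    "(b1, a3) \<in> E" "(b2, a3) \<in> E" "(b3, a3) \<in> E" "(b1, a4) \<in> E" "(b2, a4) \<in> E" "(b3, a4) \<in> E"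
    by (simp_all add: E)
  have P: "pa \<noteq> []" "pb \<noteq> []" "pc \<noteq> []" "pd \<noteq> []"
    "last pa \<in> A" "last pb \<in> A" "last pc \<in> A" "last pd \<in> A"
    "successively (\<lambda>x y. (x, y) \<in> E) (a1 # pa)" "successively (\<lambda>x y. (x, y) \<in> E) (a2 # pb)"
    "successively (\<lambda>x y. (x, y) \<in> E) (a3 # pc)" "successively (\<lambda>x y. (x, y) \<in> E) (a4 # pd)"
    using assms(5) by simp_all
  have b: "fan E b A [a1 # pa, a2 # pb, a3 # pc, a4 # pd]" if b: "b \<in> {b1, b2, b3}" for b
  proof -
    have "distinct (b # concat [a1 # pa, a2 # pb, a3 # pc, a4 # pd])"
      using dist b by auto
    moreover have "(b, a1) \<in> E" "(b, a2) \<in> E" "(b, a3) \<in> E" "(b, a4) \<in> E" using b E' by auto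
    ultimately show ?thesis using P by (simp add: fan_def)
  qed
  have a: "fan E a1 A [pa, b1 # a2 # pb, b2 # a3 # pc, b3 # a4 # pd]"
    "fan E a2 A [pb, b1 # a1 # pa, b2 # a3 # pc, b3 # a4 # pd]"
    "fan E a3 A [pc, b1 # a1 # pa, b2 # a2 # pb, b3 # a4 # pd]"
    "fan E a4 A [pd, b1 # a1 # pa, b2 # a2 # pb, b3 # a3 # pc]"
  proof -
    have "distinct (a1 # concat [pa, b1 # a2 # pb, b2 # a3 # pc, b3 # a4 # pd])"
      "distinct (a2 # concat [pb, b1 # a1 # pa, b2 # a3 # pc, b3 # a4 # pd])"
      "distinct (a3 # concat [pc, b1 # a1 # pa, b2 # a2 # pb, b3 # a4 # pd])"
      "distinct (a4 # concat [pd, b1 # a1 # pa, b2 # a2 # pb, b3 # a3 # pc])"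
      using dist by auto
    then show "fan E a1 A [pa, b1 # a2 # pb, b2 # a3 # pc, b3 # a4 # pd]"
      "fan E a2 A [pb, b1 # a1 # pa, b2 # a3 # pc, b3 # a4 # pd]"
      "fan E a3 A [pc, b1 # a1 # pa, b2 # a2 # pb, b3 # a4 # pd]"
      "fan E a4 A [pd, b1 # a1 # pa, b2 # a2 # pb, b3 # a3 # pc]"
      using P E' by (simp_all add: fan_def)
  qed
  \<comment> \<open>All fans end in the original \<open>A\<close>, so they remain usable while the
    set grows.\<close>
  have "robust E (insert b3 A)"
    by (rule robust_insert[OF assms(1,2) b]) auto
  then have "robust E (insert b2 (insert b3 A))"
    by (rule robust_insert[OF assms(1) _ b]) auto
  then have "robust E (insert b1 (insert b2 (insert b3 A)))"
    by (rule robust_insert[OF assms(1) _ b]) auto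
  then have "robust E (insert a4 (insert b1 (insert b2 (insert b3 A))))"
    by (rule robust_insert[OF assms(1) _ a(4)]) auto
  then have "robust E (insert a3 (insert a4 (insert b1 (insert b2 (insert b3 A)))))"
    by (rule robust_insert[OF assms(1) _ a(3)]) auto
  then have "robust E (insert a2 (insert a3 (insert a4 (insert b1 (insert b2 (insert b3 A))))))"
    by (rule robust_insert[OF assms(1) _ a(2)]) auto
  then have "robust E (insert a1 (insert a2 (insert a3 (insert a4 (insert b1 (insert b2 (insert b3 A)))))))"
    by (rule robust_insert[OF assms(1) _ a(1)]) auto
  then show ?thesis by simp
qed

lemma vertex_connected_if_robust:
  fixes G :: "'a pair_pre_digraph"
  assumes "pair_graph G" "robust (parcs G) (pverts G)" "4 < card (pverts G)"
  shows "vertex_connected 4 G"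
  unfolding vertex_connected_def
proof (intro conjI allI impI)
  interpret pair_graph G by fact
  fix S assume S: "S \<subseteq> pverts G" "card S < 4"
  \<comment> \<open>Connectedness is strong connectedness of the symmetric closure, so the argument
    is carried out in \<open>H\<close>.\<close>
  define H where "H = with_proj (mk_symmetric (with_proj G \<restriction> (pverts G - S)))"
  have vH: "verts H = pverts G - S" by (simp add: H_def mk_symmetric_def)
  have aH: "Restr (parcs G) (- S) \<subseteq> arcs_ends H"
  proof (clarsimp simp: H_def mk_symmetric_def)
    fix u v assume "(u, v) \<in> parcs G" "u \<notin> S" "v \<notin> S"
    then show "\<exists>a b. (a, b) \<in> parcs G \<and> a \<in> pverts G \<and> a \<notin> S \<and> b \<in> pverts G \<and> b \<notin> S \<and>
        (u = a \<and> v = b \<or> u = b \<and> v = a)"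
      using in_arcsD1 in_arcsD2 by blast
  qed
  have fin: "finite S" using S(1) pair_finite_verts finite_subset by blast
  have reach: "u \<rightarrow>\<^sup>*\<^bsub>H\<^esub> v" if "(u, v) \<in> (Restr (parcs G) (- S))\<^sup>*" "u \<in> verts H" for u v
    using that
  proof (induction rule: rtrancl_induct)
    case base
    then show ?case by (simp add: reachable_def)
  next
    case (step y z)
    then have "(y, z) \<in> arcs_ends H" using aH by blast
    moreover have "z \<in> verts H" using step.hyps(2) in_arcsD2 vH by auto
    ultimately show ?case using step unfolding reachable_def
      by (meson rtrancl_on.rtrancl_on_into_rtrancl_on)
  qed
  have "strongly_connected H"
    unfolding strongly_connected_def
  proof (intro conjI ballI)
    show "verts H \<noteq> {}"
    proof
      assume "verts H = {}"
      then have "card (pverts G) \<le> card S" using vH fin by (intro card_mono) auto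
      then show False using S(2) assms(3) by simp
    qed
    show "u \<rightarrow>\<^sup>*\<^bsub>H\<^esub> v" if "u \<in> verts H" "v \<in> verts H" for u v
      using that assms(2) S(2) fin vH reach unfolding robust_def by blast
  qed
  then show "connected (with_proj G \<restriction> (pverts G - S))" by (simp add: connected_def H_def)
qed (rule assms(3))

section \<open>4-connectivity\<close>

lemma robust_cap_blob:
  assumes "113 \<le> N" "robust (parcs (chain_graph N)) A" "b < 98" "b mod 7 = 0"
    and "distinct ([b, b + 1, b + 2, b + 3, b + 4, b + 5, b + 6] @ pa @ pb @ pc @ pd)"
    and "\<forall>(a, p) \<in> {(b, pa), (b + 1, pb), (b + 2, pc), (b + 3, pd)}.
           p \<noteq> [] \<and> successively (\<lambda>x y. (x, y) \<in> parcs (chain_graph N)) (a # p) \<and> last p \<in> A"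
  shows "robust (parcs (chain_graph N)) ({b..<b + 7} \<union> A)"
proof -
  obtain j where b: "b = 7 * j" using assms(4) by auto
  have "j < 14" using assms(3) b by simp
  then have "\<forall>x \<in> {b, b + 1, b + 2, b + 3}. \<forall>y \<in> {b + 4, b + 5, b + 6}. (x, y) \<in> parcs (chain_graph N)"
    using assms(1) unfolding b by (auto simp: nbrs_def cap_nbrs_def Let_def mod_Suc)
  then have "robust (parcs (chain_graph N)) ({b, b + 1, b + 2, b + 3, b + 4, b + 5, b + 6} \<union> A)"
    using assms(1) by (intro robust_blob[OF sym_parcs_graph assms(2,5) _ assms(6)]) simp_all
  also have "{b, b + 1, b + 2, b + 3, b + 4, b + 5, b + 6} = {b..<b + 7}" by auto
  finally show ?thesis .
qed

text \<open>The robust set grows from one blob over the whole cap. The path lists are certificates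
  checked by evaluation; their inner vertices may be not yet absorbed, even strip vertices up to
  108, as only the endpoints must lie in the current set.\<close>

lemma robust_cap:
  assumes "113 \<le> N"
  shows "robust (parcs (chain_graph N)) {..<104}"
proof -
  let ?E = "parcs (chain_graph N)"
  note [simp] = nbrs_simps[OF assms] fan_def
  have [simp]: "cap_nbrs (Suc (Suc 0)) = [4, 5, 6, 7]" by (simp flip: numeral_2_eq_2)
  have N: "108 \<le> N" using assms by simp
  have "robust ?E {84, 88, 89, 90}"
    by (rule robust_common_neighbours[OF sym_parcs_graph[OF N], of 84 85 86 87]) (use assms in simp_all)
  \<comment> \<open>Each remaining vertex of the larger side has three direct edges to 88, 89, 90;
    only the fourth path needs a detour outside the blob.\<close>
  then have "robust ?E ({85, 84, 88, 89, 90})"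
    by (rule robust_insert[OF sym_parcs_graph[OF N] _ _ subset_refl, where ps =
      "[[50,53,49,102,101,98,84], [88], [89], [90]]"])
      (use assms in simp_all)
  then have "robust ?E ({86, 85, 84, 88, 89, 90})"
    by (rule robust_insert[OF sym_parcs_graph[OF N] _ _ subset_refl, where ps =
      "[[77,81,80,71,74,73,92,96,94,99,104,103,98,84], [88], [89], [90]]"])
      (use assms in simp_all)
  then have "robust ?E ({87, 86, 85, 84, 88, 89, 90})"
    by (rule robust_insert[OF sym_parcs_graph[OF N] _ _ subset_refl, where ps =
      "[[78,81,77,86], [88], [89], [90]]"])
      (use assms in simp_all)
  also have "{87, 86, 85, 84, 88, 89, 90} = {84..<84 + 7::nat}" by auto
  finally have "robust ?E {84..<84 + 7}" .
  then have "robust ?E ({70..<70 + 7} \<union> {84..<84 + 7})"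
    by (rule robust_cap_blob[OF assms, of _ 70
      "[79,81,77,86]" "[80,82,78,87]" "[65,67,64,59,60,56,51,53,50,85]" "[92,96,94,99,104,103,98,84]"])
      (use assms in simp_all)
  then have "robust ?E ({77..<77 + 7} \<union> ({70..<70 + 7} \<union> {84..<84 + 7}))"
    by (rule robust_cap_blob[OF assms, of _ 77
      "[86]" "[87]" "[70]" "[71]"])
      (use assms in simp_all)
  then have "robust ?E ({49..<49 + 7} \<union> ({77..<77 + 7} \<union> ({70..<70 + 7} \<union> {84..<84 + 7})))"
    by (rule robust_cap_blob[OF assms, of _ 49
      "[102,101,98,84]" "[85]" "[56,60,58,63,67,65,72]" "[57,61,59,64,68,66,91,96,92,73]"])
      (use assms in simp_all)
  then have "robust ?E ({56..<56 + 7} \<union> ({49..<49 + 7} \<union> ({77..<77 + 7} \<union> ({70..<70 + 7} \<union> {84..<84 + 7}))))"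
    by (rule robust_cap_blob[OF assms, of _ 56
      "[51]" "[52]" "[63,67,65,72]" "[64,68,66,91,96,92,73]"])
      (use assms in simp_all)
  then have "robust ?E ({63..<63 + 7} \<union> ({56..<56 + 7} \<union> ({49..<49 + 7} \<union> ({77..<77 + 7} \<union> ({70..<70 + 7} \<union> {84..<84 + 7})))))"
    by (rule robust_cap_blob[OF assms, of _ 63
      "[58]" "[59]" "[72]" "[91,96,92,73]"])
      (use assms in simp_all)
  then have "robust ?E (insert 99 ({63..<63 + 7} \<union> ({56..<56 + 7} \<union> ({49..<49 + 7} \<union> ({77..<77 + 7} \<union> ({70..<70 + 7} \<union> {84..<84 + 7}))))))"
    by (rule robust_insert[OF sym_parcs_graph[OF N] _ _ subset_refl, where ps =
      "[[45,48,44,93,97,92,73], [94,96,91,66], [100,101,98,84], [104,103,102,49]]"])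
      (use assms in simp_all)
  then have "robust ?E ({91..<91 + 7} \<union> (insert 99 ({63..<63 + 7} \<union> ({56..<56 + 7} \<union> ({49..<49 + 7} \<union> ({77..<77 + 7} \<union> ({70..<70 + 7} \<union> {84..<84 + 7})))))))"
    by (rule robust_cap_blob[OF assms, of _ 91
      "[66]" "[73]" "[44,48,43,24,25,21,30,32,28,37,40,35,98,84]" "[99]"])
      (use assms in simp_all)
  then have "robust ?E (insert 98 ({91..<91 + 7} \<union> (insert 99 ({63..<63 + 7} \<union> ({56..<56 + 7} \<union> ({49..<49 + 7} \<union> ({77..<77 + 7} \<union> ({70..<70 + 7} \<union> {84..<84 + 7}))))))))"
    by (rule robust_insert[OF sym_parcs_graph[OF N] _ _ subset_refl, where ps =
      "[[35,40,37,28,32,30,21,25,24,43,48,44,93], [84], [101,100,99], [103,102,49]]"])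
      (use assms in simp_all)
  then have "robust ?E (insert 100 (insert 98 ({91..<91 + 7} \<union> (insert 99 ({63..<63 + 7} \<union> ({56..<56 + 7} \<union> ({49..<49 + 7} \<union> ({77..<77 + 7} \<union> ({70..<70 + 7} \<union> {84..<84 + 7})))))))))"
    by (rule robust_insert[OF sym_parcs_graph[OF N] _ _ subset_refl, where ps =
      "[[0,4,2,7,11,9,14,18,17,42,48,44,93], [99], [101,98], [105,104,103,102,49]]"])
      (use assms in simp_all)
  then have "robust ?E (insert 101 (insert 100 (insert 98 ({91..<91 + 7} \<union> (insert 99 ({63..<63 + 7} \<union> ({56..<56 + 7} \<union> ({49..<49 + 7} \<union> ({77..<77 + 7} \<union> ({70..<70 + 7} \<union> {84..<84 + 7}))))))))))"
    by (rule robust_insert[OF sym_parcs_graph[OF N] _ _ subset_refl, where ps =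
      "[[98], [100], [102,49], [106,105,104,99]]"])
      (use assms in simp_all)
  then have "robust ?E (insert 102 (insert 101 (insert 100 (insert 98 ({91..<91 + 7} \<union> (insert 99 ({63..<63 + 7} \<union> ({56..<56 + 7} \<union> ({49..<49 + 7} \<union> ({77..<77 + 7} \<union> ({70..<70 + 7} \<union> {84..<84 + 7})))))))))))"
    by (rule robust_insert[OF sym_parcs_graph[OF N] _ _ subset_refl, where ps =
      "[[49], [101], [103,98], [107,106,105,100]]"])
      (use assms in simp_all)
  then have "robust ?E (insert 103 (insert 102 (insert 101 (insert 100 (insert 98 ({91..<91 + 7} \<union> (insert 99 ({63..<63 + 7} \<union> ({56..<56 + 7} \<union> ({49..<49 + 7} \<union> ({77..<77 + 7} \<union> ({70..<70 + 7} \<union> {84..<84 + 7}))))))))))))"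
    by (rule robust_insert[OF sym_parcs_graph[OF N] _ _ subset_refl, where ps =
      "[[98], [102], [104,99], [108,107,106,101]]"])
      (use assms in simp_all)
  then have "robust ?E ({42..<42 + 7} \<union> (insert 103 (insert 102 (insert 101 (insert 100 (insert 98 ({91..<91 + 7} \<union> (insert 99 ({63..<63 + 7} \<union> ({56..<56 + 7} \<union> ({49..<49 + 7} \<union> ({77..<77 + 7} \<union> ({70..<70 + 7} \<union> {84..<84 + 7})))))))))))))"
    by (rule robust_cap_blob[OF assms, of _ 42
      "[17,18,14,9,11,8,3,4,0,100]" "[24,25,21,30,32,28,37,40,35,98]" "[93]" "[99]"])
      (use assms in simp_all)
  then have "robust ?E ({0..<0 + 7} \<union> ({42..<42 + 7} \<union> (insert 103 (insert 102 (insert 101 (insert 100 (insert 98 ({91..<91 + 7} \<union> (insert 99 ({63..<63 + 7} \<union> ({56..<56 + 7} \<union> ({49..<49 + 7} \<union> ({77..<77 + 7} \<union> ({70..<70 + 7} \<union> {84..<84 + 7}))))))))))))))"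
    by (rule robust_cap_blob[OF assms, of _ 0
      "[100]" "[36,40,35,98]" "[7,11,9,14,18,17,42]" "[8,12,10,15,19,16,23,25,24,43]"])
      (use assms in simp_all)
  then have "robust ?E ({7..<7 + 7} \<union> ({0..<0 + 7} \<union> ({42..<42 + 7} \<union> (insert 103 (insert 102 (insert 101 (insert 100 (insert 98 ({91..<91 + 7} \<union> (insert 99 ({63..<63 + 7} \<union> ({56..<56 + 7} \<union> ({49..<49 + 7} \<union> ({77..<77 + 7} \<union> ({70..<70 + 7} \<union> {84..<84 + 7})))))))))))))))"
    by (rule robust_cap_blob[OF assms, of _ 7
      "[2]" "[3]" "[14,18,17,42]" "[15,19,16,23,25,24,43]"])
      (use assms in simp_all)
  then have "robust ?E ({14..<14 + 7} \<union> ({7..<7 + 7} \<union> ({0..<0 + 7} \<union> ({42..<42 + 7} \<union> (insert 103 (insert 102 (insert 101 (insert 100 (insert 98 ({91..<91 + 7} \<union> (insert 99 ({63..<63 + 7} \<union> ({56..<56 + 7} \<union> ({49..<49 + 7} \<union> ({77..<77 + 7} \<union> ({70..<70 + 7} \<union> {84..<84 + 7}))))))))))))))))"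
    by (rule robust_cap_blob[OF assms, of _ 14
      "[9]" "[10]" "[23,25,24,43]" "[42]"])
      (use assms in simp_all)
  then have "robust ?E ({21..<21 + 7} \<union> ({14..<14 + 7} \<union> ({7..<7 + 7} \<union> ({0..<0 + 7} \<union> ({42..<42 + 7} \<union> (insert 103 (insert 102 (insert 101 (insert 100 (insert 98 ({91..<91 + 7} \<union> (insert 99 ({63..<63 + 7} \<union> ({56..<56 + 7} \<union> ({49..<49 + 7} \<union> ({77..<77 + 7} \<union> ({70..<70 + 7} \<union> {84..<84 + 7})))))))))))))))))"
    by (rule robust_cap_blob[OF assms, of _ 21
      "[30,32,28,37,40,35,98]" "[31,33,29,38,41,36,Suc 0]" "[16]" "[43]"])
      (use assms in simp_all)
  then have "robust ?E ({28..<28 + 7} \<union> ({21..<21 + 7} \<union> ({14..<14 + 7} \<union> ({7..<7 + 7} \<union> ({0..<0 + 7} \<union> ({42..<42 + 7} \<union> (insert 103 (insert 102 (insert 101 (insert 100 (insert 98 ({91..<91 + 7} \<union> (insert 99 ({63..<63 + 7} \<union> ({56..<56 + 7} \<union> ({49..<49 + 7} \<union> ({77..<77 + 7} \<union> ({70..<70 + 7} \<union> {84..<84 + 7}))))))))))))))))))"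
    by (rule robust_cap_blob[OF assms, of _ 28
      "[37,40,35,98]" "[38,41,36,Suc 0]" "[21]" "[22]"])
      (use assms in simp_all)
  then have "robust ?E ({35..<35 + 7} \<union> ({28..<28 + 7} \<union> ({21..<21 + 7} \<union> ({14..<14 + 7} \<union> ({7..<7 + 7} \<union> ({0..<0 + 7} \<union> ({42..<42 + 7} \<union> (insert 103 (insert 102 (insert 101 (insert 100 (insert 98 ({91..<91 + 7} \<union> (insert 99 ({63..<63 + 7} \<union> ({56..<56 + 7} \<union> ({49..<49 + 7} \<union> ({77..<77 + 7} \<union> ({70..<70 + 7} \<union> {84..<84 + 7})))))))))))))))))))"
    by (rule robust_cap_blob[OF assms, of _ 35
      "[98]" "[Suc 0]" "[28]" "[29]"])
      (use assms in simp_all)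
  also have "{35..<35 + 7} \<union> ({28..<28 + 7} \<union> ({21..<21 + 7} \<union> ({14..<14 + 7} \<union> ({7..<7 + 7} \<union> ({0..<0 + 7} \<union> ({42..<42 + 7} \<union> (insert 103 (insert 102 (insert 101 (insert 100 (insert 98 ({91..<91 + 7} \<union> (insert 99 ({63..<63 + 7} \<union> ({56..<56 + 7} \<union> ({49..<49 + 7} \<union> ({77..<77 + 7} \<union> ({70..<70 + 7} \<union> {84..<84 + 7})))))))))))))))))) = {..<104::nat}"
    by (rule set_eqI, simp only: Un_iff insert_iff empty_iff atLeastLessThan_iff lessThan_iff, presburger)
  finally show ?thesis .
qed

lemma upper_simps:
  "q + 5 \<le> N \<Longrightarrow> upper N q = [q + 1, q + 5]" "q + 4 = N \<Longrightarrow> upper N q = [q + 1, q + 4]"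
  "q + 3 = N \<Longrightarrow> upper N q = [q + 1, q + 2]" "q + 2 = N \<Longrightarrow> upper N q = [q + 1, q + 2]"
  "q + 1 = N \<Longrightarrow> upper N q = [q + 1, q - 2]" "q = N \<Longrightarrow> upper N q = [q - 2, q - 4]"
  by (auto simp: upper_def)

text \<open>The fans below end in the two lower neighbours and, via detours to the right, in \<open>q - 4\<close> and \<open>q - 2\<close>.\<close>

lemma robust_strip:
  assumes "113 \<le> N" "q + 108 \<le> N"
  shows "robust (parcs (chain_graph N)) {..<q + 104}"
  using assms(2)
proof (induction q)
  case 0
  then show ?case using robust_cap[OF assms(1)] by simp
next
  case (Suc q)
  have sym: "sym (parcs (chain_graph N))" using assms(1) by (simp add: sym_parcs_graph)
  let ?ps = "[[q + 103], [q + 99], [q + 105, q + 100], [q + 109, q + 108, q + 107, q + 102]]"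
  have "q + 107 \<in> set (nbrs N (q + 108))" "q + 102 \<in> set (nbrs N (q + 107))"
    "q + 108 \<in> set (nbrs N (q + 109))" "q + 109 \<in> set (nbrs N (q + 104))" "q + 105 \<in> set (nbrs N (q + 104))"
    "q + 103 \<in> set (nbrs N (q + 104))" "q + 99 \<in> set (nbrs N (q + 104))" "q + 100 \<in> set (nbrs N (q + 105))"
    using Suc.prems by (simp_all add: nbrs_def lower_def upper_simps(1))
  then have "fan (parcs (chain_graph N)) (q + 104) {..<q + 104} ?ps"
    using Suc.prems by (simp add: fan_def)
  have "{..<Suc q + 104} = insert (q + 104) {..<q + 104}" by auto
  with robust_insert[OF sym Suc.IH \<open>fan _ _ _ _\<close> subset_refl] Suc.prems
  show ?case by simp
qed

text \<open>The last five vertices lack the generic detours to the right; the closing edges at the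
  end of the strip replace them.\<close>

lemma robust_graph:
  assumes "113 \<le> N"
  shows "robust (parcs (chain_graph N)) {..N}"
proof -
  let ?E = "parcs (chain_graph N)"
  have sym: "sym ?E" using assms by (simp add: sym_parcs_graph)
  obtain m where N: "N = m + 113" using assms by (metis le_add_diff_inverse add.commute)
  note [simp] = fan_def nbrs_def lower_def upper_simps N
  have "robust ?E {..<m + 109}" using robust_strip[OF assms, of "m + 5"] by (simp add: add.commute)
  moreover have "fan ?E (m + 109) {..<m + 109}
      [[m + 108], [m + 104], [m + 110, m + 105], [m + 113, m + 112, m + 107]]" by simp
  ultimately have "robust ?E (insert (m + 109) {..<m + 109})"
    by (rule robust_insert[OF sym]) simp
  moreover have "fan ?E (m + 110) (insert (m + 109) {..<m + 109})
      [[m + 109], [m + 105], [m + 111, m + 106], [m + 112, m + 107]]" by simp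
  ultimately have "robust ?E (insert (m + 110) (insert (m + 109) {..<m + 109}))"
    by (rule robust_insert[OF sym]) simp
  moreover have "fan ?E (m + 111) (insert (m + 110) (insert (m + 109) {..<m + 109}))
      [[m + 110], [m + 106], [m + 112, m + 107], [m + 113, m + 108]]" by simp
  ultimately have "robust ?E (insert (m + 111) (insert (m + 110) (insert (m + 109) {..<m + 109})))"
    by (rule robust_insert[OF sym]) simp
  moreover have "fan ?E (m + 112) (insert (m + 111) (insert (m + 110) (insert (m + 109) {..<m + 109})))
      [[m + 111], [m + 107], [m + 110], [m + 113, m + 108]]" by simp
  ultimately have "robust ?E (insert (m + 112) (insert (m + 111) (insert (m + 110) (insert (m + 109) {..<m + 109}))))"
    by (rule robust_insert[OF sym]) simp
  moreover have "fan ?E (m + 113)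
      (insert (m + 112) (insert (m + 111) (insert (m + 110) (insert (m + 109) {..<m + 109}))))
      [[m + 112], [m + 108], [m + 111], [m + 109]]" by simp
  ultimately have "robust ?E (insert (m + 113) (insert (m + 112) (insert (m + 111) (insert (m + 110) (insert (m + 109) {..<m + 109})))))"
    by (rule robust_insert[OF sym]) simp
  also have "insert (m + 113) (insert (m + 112) (insert (m + 111) (insert (m + 110) (insert (m + 109) {..<m + 109})))) = {..N}"
    by auto
  finally show ?thesis .
qed

lemma vertex_connected_graph: "113 \<le> N \<Longrightarrow> vertex_connected 4 (chain_graph N)"
  by (rule vertex_connected_if_robust) (simp_all add: pair_graph_graph robust_graph)

section \<open>Hamiltonian cycles are determined by their first edges\<close>

locale hamiltonian_graph =
  fixes N :: nat and C :: "nat set set"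
  assumes N: "113 \<le> N" and C: "C \<in> hamiltonian_cycles (chain_graph N)"
begin

section \<open>Degree and cut conditions as linear constraints on 0-1 variables\<close>

definition x :: "nat \<Rightarrow> nat \<Rightarrow> nat" where
  "x u v = (if {u, v} \<in> C then 1 else 0)"

lemma x_le: "x u v \<le> 1"
  by (simp add: x_def)

lemma x_commute: "x u v = x v u"
  by (simp add: x_def insert_commute)

lemma degree: "v \<le> N \<Longrightarrow> sum_list (map (x v) (nbrs N v)) = 2"
proof -
  assume v: "v \<le> N"
  have "{w. {v, w} \<in> C} = {w \<in> set (nbrs N v). {v, w} \<in> C}"
  proof (intro set_eqI iffI; clarsimp)
    fix w assume e: "{v, w} \<in> C"
    obtain a b where ab: "{v, w} = {a, b}" "(a, b) \<in> parcs (chain_graph N)"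
      using hamiltonian_cycle_arcs[OF C e] by metis
    moreover have "(b, a) \<in> parcs (chain_graph N)" using symD[OF sym_parcs_graph ab(2)] N by simp
    ultimately show "w \<in> set (nbrs N v)" by (auto simp: doubleton_eq_iff)
  qed
  then have "2 = card {w \<in> set (nbrs N v). {v, w} \<in> C}"
    using hamiltonian_cycle_degree[OF C, of v] v by simp
  also have "\<dots> = (\<Sum>w\<in>set (nbrs N v). x v w)"
    unfolding x_def card_eq_sum by (rule sum.inter_filter) simp
  also have "\<dots> = sum_list (map (x v) (nbrs N v))"
    using nbrs(1)[of N v] N v by (simp add: sum_list_distinct_conv_sum_set)
  finally show ?thesis by simp
qed

lemma cut:
  assumes "u \<in> X" "u \<le> N" "v \<notin> X" "v \<le> N"
  obtains a b where "a \<in> X" "b \<notin> X" "a \<le> N" "b \<in> set (nbrs N a)" "x a b = 1"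
proof -
  have "u \<in> pverts (chain_graph N)" "v \<in> pverts (chain_graph N)" using assms(2,4) by simp_all
  from hamiltonian_cycle_cut[OF C assms(1) this assms(3)]
  obtain a b where "a \<in> X" "b \<notin> X" "(a, b) \<in> parcs (chain_graph N)" "{a, b} \<in> C" by metis
  then show ?thesis using that by (simp add: x_def)
qed

text \<open>
  The degree sum of the larger side of a blob is \<open>8\<close>, that of the smaller side is \<open>6\<close>, so a
  Hamiltonian cycle uses exactly two of the four edges leaving a blob.
\<close>

lemma blob_degree:
  assumes "b mod 7 = 0" "b < 98"
  shows "x b (partner b) + x (b + 1) (partner (b + 1)) + x (b + 2) (partner (b + 2)) +
    x (b + 3) (partner (b + 3)) = 2"
proof -
  obtain j where b: "b = 7 * j" "j < 14" using assms by auto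
  have n: "nbrs N b = [b + 4, b + 5, b + 6, partner b]" "nbrs N (b + 1) = [b + 4, b + 5, b + 6, partner (b + 1)]"
    "nbrs N (b + 2) = [b + 4, b + 5, b + 6, partner (b + 2)]" "nbrs N (b + 3) = [b + 4, b + 5, b + 6, partner (b + 3)]"
    "nbrs N (b + 4) = [b, b + 1, b + 2, b + 3]" "nbrs N (b + 5) = [b, b + 1, b + 2, b + 3]"
    "nbrs N (b + 6) = [b, b + 1, b + 2, b + 3]"
    using b by (auto simp: nbrs_def cap_nbrs_def Let_def mod_Suc)
  have "sum_list (map (x v) (nbrs N v)) = 2" if "v \<le> b + 6" for v
    using that degree assms(2) N by simp
  note d = this[of b] this[of "b + 1"] this[of "b + 2"] this[of "b + 3"]
    this[of "b + 4"] this[of "b + 5"] this[of "b + 6"]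
  show ?thesis
    using d unfolding n
    by (simp add: x_commute[of "b + 4"] x_commute[of "b + 5"] x_commute[of "b + 6"])
qed

text \<open>The cycle must leave a union of consecutive blobs to reach 98. The filter computes the
  vertices whose leaving edge crosses the boundary.\<close>

lemma cut_blobs:
  assumes "c mod 7 = 0" "d mod 7 = 0" "c < d" "d \<le> 98"
  shows "\<exists>u \<in> set (filter (\<lambda>u. u mod 7 < 4 \<and> \<not> (c \<le> partner u \<and> partner u < d)) [c..<d]).
    x u (partner u) = 1"
proof -
  obtain a b where ab: "a \<in> {c..<d}" "b \<notin> {c..<d}" "b \<in> set (nbrs N a)" "x a b = 1"
    using cut[of c "{c..<d}" 98] assms N by auto
  obtain i where a: "a = 7 * i + a mod 7" by (metis mult_div_mod_eq)
  obtain j where j: "c = 7 * j" using assms(1) by auto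
  obtain k where k: "d = 7 * k" using assms(2) by auto
  note cd = j k
  have i: "j \<le> i" "i < k"
    using ab(1) cd a pos_mod_bound[of 7 a] by auto
  \<comment> \<open>Every other edge at \<open>a\<close> stays in its blob, hence inside the
    union.\<close>
  have "a mod 7 < 4 \<and> b = partner a"
  proof (rule ccontr)
    assume "\<not> ?thesis"
    then have "b \<in> {7 * i..<7 * i + 7}"
      using ab(1,3) assms(4) a by (auto simp: nbrs_def cap_nbrs_def Let_def split: if_splits)
    then show False using ab(2) cd i by auto
  qed
  then show ?thesis using ab by auto
qed

section \<open>Edges forced by the gadget\<close>

text \<open>
  In a rung, \<open>t\<close> and \<open>s\<close> count the used edges in the two double edges; connectivity excludes
  \<open>t = 2\<close> and \<open>s = 2\<close>, so exactly one of the two outer edges is used at each end.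
\<close>

lemma rung:
  fixes l t s r :: nat
  assumes "l + t = 2" "t + s = 2" "s + r = 2" "1 \<le> l + s" "1 \<le> t + r"
  shows "l = 1" "r = 1"
  using assms by presburger+

text \<open>
  Here \<open>d\<close>, \<open>d'\<close> are the outer edges of the two rungs, \<open>e\<close> and \<open>f\<close> the edges joining the rungs,
  \<open>g\<close>, \<open>g'\<close> the edges to the seventh blob and \<open>o1\<close>, \<open>o2\<close> its remaining edges. If \<open>e\<close> were used,
  the two rungs (or the whole piece) would carry a closed cycle.
\<close>

lemma piece:
  fixes d d' e f g g' o1 o2 :: nat
  assumes "d + e = 1" "d' + e = 1" "f + g = 1" "f + g' = 1" "g + g' + o1 + o2 = 2"
    and "1 \<le> d + d' + g + g'" "1 \<le> d + d' + o1 + o2" "o1 \<le> 1" "o2 \<le> 1"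
  shows "d = 1" "d' = 1" "o1 = o2" "g + o1 = 1" "g' + o1 = 1"
proof -
  have "e = 0 \<or> e = 1" "f = 0 \<or> f = 1" using assms(1,3) by linarith+
  then show "d = 1" "d' = 1" "o1 = o2" "g + o1 = 1" "g' + o1 = 1" using assms by auto
qed

text \<open>In the notation of \<open>piece\<close>, \<open>d\<close> and \<open>d'\<close> are
  0-100 and 35-98, \<open>e\<close> is 1-36, \<open>f\<close> is 16-23, \<open>g\<close> and
  \<open>g'\<close> are 17-42 and 24-43, and \<open>o1\<close>, \<open>o2\<close> are 44-93 and
  45-99.\<close>

lemma piece_one: "x 0 100 = 1" "x 35 98 = 1" "x 44 93 = x 45 99" "x 17 42 + x 44 93 = 1" "x 24 43 + x 44 93 = 1"
proof -
  note [simp] = partner_simps upt_conv_Cons numeral_2_eq_2[symmetric]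
  have 0: "(x 0 100 + x 1 36) + (x 2 7 + x 3 8) = 2" using blob_degree[of 0] by simp
  have 1: "(x 2 7 + x 3 8) + (x 9 14 + x 10 15) = 2" using blob_degree[of 7] by (simp add: x_commute)
  have 2: "(x 9 14 + x 10 15) + (x 16 23 + x 17 42) = 2" using blob_degree[of 14] by (simp add: x_commute)
  have 3: "(x 30 21 + x 31 22) + (x 16 23 + x 24 43) = 2" using blob_degree[of 21] by (simp add: x_commute)
  have 4: "(x 37 28 + x 38 29) + (x 30 21 + x 31 22) = 2" using blob_degree[of 28] by (simp add: x_commute)
  have 5: "(x 35 98 + x 1 36) + (x 37 28 + x 38 29) = 2" using blob_degree[of 35] by (simp add: x_commute)
  have 6: "x 17 42 + x 24 43 + x 44 93 + x 45 99 = 2" using blob_degree[of 42] by (simp add: x_commute)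
  \<comment> \<open>The first four cuts surround two adjacent blobs of a rung, the fifth both rungs,
    the sixth the whole piece.\<close>
  have c1: "1 \<le> (x 0 100 + x 1 36) + (x 9 14 + x 10 15)" using cut_blobs[of 0 14] by (auto simp: x_commute)
  have c2: "1 \<le> (x 2 7 + x 3 8) + (x 16 23 + x 17 42)" using cut_blobs[of 7 21] by (auto simp: x_commute)
  have c3: "1 \<le> (x 16 23 + x 24 43) + (x 37 28 + x 38 29)" using cut_blobs[of 21 35] by (auto simp: x_commute)
  have c4: "1 \<le> (x 35 98 + x 1 36) + (x 30 21 + x 31 22)" using cut_blobs[of 28 42] by (auto simp: x_commute)
  have c5: "1 \<le> x 0 100 + x 35 98 + x 17 42 + x 24 43" using cut_blobs[of 0 42] by (auto simp: x_commute)
  have c6: "1 \<le> x 0 100 + x 35 98 + x 44 93 + x 45 99" using cut_blobs[of 0 49] by (auto simp: x_commute)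
  have r1: "x 0 100 + x 1 36 = 1" "x 16 23 + x 17 42 = 1" using rung[OF 0 1 2 c1 c2] .
  have r2: "x 35 98 + x 1 36 = 1" "x 16 23 + x 24 43 = 1"
    using rung[OF 5 4 3] c3 c4 by linarith+
  show "x 0 100 = 1" "x 35 98 = 1" "x 44 93 = x 45 99" "x 17 42 + x 44 93 = 1" "x 24 43 + x 44 93 = 1"
    using piece[OF r1(1) r2(1) r1(2) r2(2) 6 c5 c6 x_le x_le] .
qed

text \<open>The same argument for the copy shifted by 49. Both pieces share 44-93 as their
  \<open>o1\<close>, which couples their seventh blobs.\<close>

lemma piece_two: "x 49 102 = 1" "x 84 98 = 1" "x 44 93 = x 94 99" "x 66 91 + x 44 93 = 1" "x 73 92 + x 44 93 = 1"
proof -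
  note [simp] = partner_simps upt_conv_Cons
  have 0: "(x 49 102 + x 50 85) + (x 51 56 + x 52 57) = 2" using blob_degree[of 49] by simp
  have 1: "(x 51 56 + x 52 57) + (x 58 63 + x 59 64) = 2" using blob_degree[of 56] by (simp add: x_commute)
  have 2: "(x 58 63 + x 59 64) + (x 65 72 + x 66 91) = 2" using blob_degree[of 63] by (simp add: x_commute)
  have 3: "(x 79 70 + x 80 71) + (x 65 72 + x 73 92) = 2" using blob_degree[of 70] by (simp add: x_commute)
  have 4: "(x 86 77 + x 87 78) + (x 79 70 + x 80 71) = 2" using blob_degree[of 77] by (simp add: x_commute)
  have 5: "(x 84 98 + x 50 85) + (x 86 77 + x 87 78) = 2" using blob_degree[of 84] by (simp add: x_commute)
  have 6: "x 66 91 + x 73 92 + x 44 93 + x 94 99 = 2" using blob_degree[of 91] by (simp add: x_commute)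
  have c1: "1 \<le> (x 49 102 + x 50 85) + (x 58 63 + x 59 64)" using cut_blobs[of 49 63] by (auto simp: x_commute)
  have c2: "1 \<le> (x 51 56 + x 52 57) + (x 65 72 + x 66 91)" using cut_blobs[of 56 70] by (auto simp: x_commute)
  have c3: "1 \<le> (x 65 72 + x 73 92) + (x 86 77 + x 87 78)" using cut_blobs[of 70 84] by (auto simp: x_commute)
  have c4: "1 \<le> (x 84 98 + x 50 85) + (x 79 70 + x 80 71)" using cut_blobs[of 77 91] by (auto simp: x_commute)
  have c5: "1 \<le> x 49 102 + x 84 98 + x 66 91 + x 73 92" using cut_blobs[of 49 91] by (auto simp: x_commute)
  have c6: "1 \<le> x 49 102 + x 84 98 + x 44 93 + x 94 99" using cut_blobs[of 49 98] by (auto simp: x_commute)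
  have r1: "x 49 102 + x 50 85 = 1" "x 65 72 + x 66 91 = 1" using rung[OF 0 1 2 c1 c2] .
  have r2: "x 84 98 + x 50 85 = 1" "x 65 72 + x 73 92 = 1"
    using rung[OF 5 4 3] c3 c4 by linarith+
  show "x 49 102 = 1" "x 84 98 = 1" "x 44 93 = x 94 99" "x 66 91 + x 44 93 = 1" "x 73 92 + x 44 93 = 1"
    using piece[OF r1(1) r2(1) r1(2) r2(2) 6 c5 c6 x_le x_le] .
qed

lemma start_unused: "x 45 99 = 0" "x 94 99 = 0"
proof -
  let ?X = "{42..<49} \<union> {91..<98} \<union> {99::nat}"
  obtain a b where ab: "a \<in> ?X" "b \<notin> ?X" "b \<in> set (nbrs N a)" "x a b = 1"
  proof -
    have p: "42 \<in> ?X" "42 \<le> N" "0 \<notin> ?X" "0 \<le> N" using N by simp_all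
    show thesis by (rule cut[OF p]) (use that in blast)
  qed
  have "a \<in> set [42, 43, 44, 45, 46, 47, 48, 91, 92, 93, 94, 95, 96, 97, 99]"
    using ab(1) by auto
  then have "(a, b) \<in> {(42, 17), (43, 24), (91, 66), (92, 73), (99, 100), (99, 104)}"
    using ab(2,3) unfolding list.set by (elim insertE emptyE) (simp_all add: nbrs_simps[OF N], auto)
  then have "x 17 42 = 1 \<or> x 24 43 = 1 \<or> x 66 91 = 1 \<or> x 73 92 = 1 \<or> x 99 100 = 1 \<or> x 99 104 = 1"
    using ab(4) by (auto simp: x_commute)
  moreover have "x 45 99 + x 94 99 + x 99 100 + x 99 104 = 2"
    using degree[of 99] N nbrs_simps[OF N] by (simp add: x_commute)
  moreover have "x 44 93 \<le> 1" by (rule x_le)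
  ultimately show "x 45 99 = 0" "x 94 99 = 0"
    using piece_one(3-5) piece_two(3-5) by linarith+
qed

section \<open>Propagation along the strip\<close>

text \<open>
  The two lower edges of \<open>q\<close> are both used or both unused, depending on the parity of \<open>q\<close>;
  then the two upper edges must behave in the opposite way.
\<close>

lemma strip_used:
  assumes "99 \<le> q" "q + 2 \<le> N" "w \<in> set (upper N q)"
  shows "x q w = (if odd q then 1 else 0)"
  using assms
proof (induction q arbitrary: w rule: less_induct)
  case (less q)
  have lower: "sum_list (map (x q) (lower q)) = (if odd q then 0 else 2)"
  proof (cases "q < 104")
    case True
    \<comment> \<open>The first five strip vertices have lower neighbours in the cap, so their cap
      edges come from the gadget. The degree of 98 is already spent on 35 and 84.\<close>
    have "x 98 35 + x 98 84 + x 98 101 + x 98 103 = 2"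
      using degree[of 98] N by (simp add: nbrs_simps)
    then have 98: "x 98 101 = 0" "x 98 103 = 0" using piece_one(2) piece_two(2) by (simp_all add: x_commute)
    have prev: "x q p = (if odd p then 1 else 0)" if "99 \<le> p" "q = p + 1" for p
      unfolding x_commute[of q p] by (rule less.IH) (use that N True in \<open>simp_all add: upper_simps\<close>)
    consider "q = 99" | "q = 100" | "q = 101" | "q = 102" | "q = 103" using True less.prems(1) by linarith
    then show ?thesis
    proof cases
      case 1
      have "x 99 45 = 0" "x 99 94 = 0" using start_unused by (simp_all add: x_commute)
      with 1 show ?thesis by (simp add: lower_def)
    next
      case 2
      have "x 100 99 = 1" using prev[of 99] 2 by simp
      moreover have "x 100 0 = 1" using piece_one(1) by (simp add: x_commute)
      ultimately show ?thesis using 2 by (simp add: lower_def)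
    next
      case 3
      have "x 101 100 = 0" using prev[of 100] 3 by simp
      moreover have "x 101 98 = 0" using 98 by (simp add: x_commute)
      ultimately show ?thesis using 3 by (simp add: lower_def)
    next
      case 4
      have "x 102 101 = 1" using prev[of 101] 4 by simp
      moreover have "x 102 49 = 1" using piece_two(1) by (simp add: x_commute)
      ultimately show ?thesis using 4 by (simp add: lower_def)
    next
      case 5
      have "x 103 102 = 0" using prev[of 102] 5 by simp
      moreover have "x 103 98 = 0" using 98 by (simp add: x_commute)
      ultimately show ?thesis using 5 by (simp add: lower_def)
    qed
  next
    case False
    then have "104 \<le> q" by simp
    then obtain p where p: "q = 104 + p" using le_Suc_ex by blast
    have N': "108 \<le> N" using N by simp
    have "q \<in> set (upper N (103 + p))" "q \<in> set (upper N (99 + p))"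
      using less.prems(2) p by (simp_all add: upper_iff[OF N'])
    then have "x (103 + p) q = (if odd (103 + p) then 1 else 0)" "x (99 + p) q = (if odd (99 + p) then 1 else 0)"
      using less.IH[of "103 + p" q] less.IH[of "99 + p" q] less.prems(2) p by simp_all
    then show ?thesis using p by (simp add: lower_def x_commute)
  qed
  have "sum_list (map (x q) (upper N q)) = (if odd q then 2 else 0)"
    using lower degree[of q] less.prems(1,2) by (auto simp: nbrs_def split: if_splits)
  moreover have "length (upper N q) = 2" unfolding upper_def by simp
  then obtain v v' where "upper N q = [v, v']" by (auto simp: numeral_2_eq_2 length_Suc_conv)
  ultimately show ?case using less.prems(3) x_le[of q v] x_le[of q v'] by (auto split: if_splits)
qed

text \<open>The only edge beyond the reach of \<open>strip_used\<close> joins \<open>N - 1\<close>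
  and \<open>N\<close>; the other three edges at \<open>N - 1\<close> are known, so its degree
  decides this one.\<close>

lemma strip_edge:
  assumes "99 \<le> u" "u < v" "v \<in> set (nbrs N u)" "v \<le> N"
  shows "{u, v} \<in> C \<longleftrightarrow> odd u"
proof -
  have "v \<notin> set (lower u)" using assms(1,2) lower_iff[of u v] by auto
  then have v: "v \<in> set (upper N u)" using assms(1,3) by (simp add: nbrs_def)
  have "x u v = (if odd u then 1 else 0)"
  proof (cases "u + 2 \<le> N")
    case True
    then show ?thesis using strip_used assms(1) v by simp
  next
    case False
    then have uv: "v = N" "N = u + 1" using assms by auto
    then have "112 \<le> u" using N by simp
    then obtain m where m: "u = 112 + m" using le_Suc_ex by blast
    have "x (111 + m) u = (if odd (111 + m) then 1 else 0)" "x (107 + m) u = (if odd (107 + m) then 1 else 0)"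
      "x (110 + m) u = (if odd (110 + m) then 1 else 0)"
      using uv m by (intro strip_used; simp add: upper_simps)+
    moreover have "x u (111 + m) + x u (107 + m) + x u v + x u (110 + m) = 2"
      using degree[of u] uv m by (simp add: nbrs_def lower_def upper_simps)
    ultimately show ?thesis using m by (auto simp: x_commute split: if_splits)
  qed
  then show ?thesis by (auto simp: x_def split: if_splits)
qed

text \<open>The second set does not depend on \<open>C\<close>, so the edges within
  \<open>{..103}\<close> determine the cycle.\<close>

lemma determined:
  "C = (C \<inter> Pow {..103}) \<union>
    {{u, v} | u v. 99 \<le> u \<and> u < v \<and> v \<in> set (nbrs N u) \<and> 104 \<le> v \<and> v \<le> N \<and> odd u}"
proof (intro equalityI subsetI)
  fix e assume e: "e \<in> C"
  have N': "108 \<le> N" using N by simp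
  obtain a b where ab: "e = {a, b}" "a \<le> N" "b \<in> set (nbrs N a)"
    using hamiltonian_cycle_arcs[OF C e] by (metis parcs_graph)
  have ba: "b \<le> N" "a \<in> set (nbrs N b)" "a \<noteq> b" using nbrs(3-5)[OF N' ab(2)] ab(3) by auto
  obtain u v where uv: "e = {u, v}" "u < v" "v \<in> set (nbrs N u)" "v \<le> N"
  proof (cases "a < b")
    case True
    then show ?thesis using that[of a b] ab ba by simp
  next
    case False
    then show ?thesis using that[of b a] ab ba by (simp add: insert_commute)
  qed
  show "e \<in> (C \<inter> Pow {..103}) \<union>
    {{u, v} | u v. 99 \<le> u \<and> u < v \<and> v \<in> set (nbrs N u) \<and> 104 \<le> v \<and> v \<le> N \<and> odd u}"
  proof (cases "v \<le> 103")
    case True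
    then show ?thesis using e uv by auto
  next
    case False
    have "99 \<le> u"
    proof (rule ccontr)
      assume "\<not> 99 \<le> u"
      then have "v \<le> 103" using uv(3) nbrs_cap(3)[of u] nbrs_simps(1)[OF N, of u] by auto
      then show False using False by simp
    qed
    then show ?thesis using False e uv strip_edge[of u v] by auto
  qed
next
  fix e assume "e \<in> (C \<inter> Pow {..103}) \<union>
    {{u, v} | u v. 99 \<le> u \<and> u < v \<and> v \<in> set (nbrs N u) \<and> 104 \<le> v \<and> v \<le> N \<and> odd u}"
  then show "e \<in> C" using strip_edge by blast
qed

end

text \<open>By \<open>determined\<close>, restriction to the first 104 vertices is injective, which
  gives a bound independent of \<open>N\<close>.\<close>

lemma card_hamiltonian_cycles_graph_le:
  assumes "113 \<le> N"
  shows "finite (hamiltonian_cycles (chain_graph N))"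
    "card (hamiltonian_cycles (chain_graph N)) \<le> card (Pow (Pow {..103::nat}))"
proof -
  let ?f = "\<lambda>C. C \<inter> Pow {..103::nat}"
  have inj: "inj_on ?f (hamiltonian_cycles (chain_graph N))"
  proof (rule inj_onI)
    fix C D assume C: "C \<in> hamiltonian_cycles (chain_graph N)" and D: "D \<in> hamiltonian_cycles (chain_graph N)"
      and eq: "?f C = ?f D"
    interpret C: hamiltonian_graph N C by unfold_locales fact+
    interpret D: hamiltonian_graph N D by unfold_locales fact+
    show "C = D" by (subst C.determined, subst D.determined) (simp only: eq)
  qed
  have sub: "?f ` hamiltonian_cycles (chain_graph N) \<subseteq> Pow (Pow {..103})" by auto
  have fin: "finite (Pow (Pow {..103::nat}))" by simp
  show "finite (hamiltonian_cycles (chain_graph N))" by (rule inj_on_finite[OF inj sub fin])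
  show "card (hamiltonian_cycles (chain_graph N)) \<le> card (Pow (Pow {..103::nat}))"
    by (rule card_inj_on_le[OF inj sub fin])
qed

section \<open>A Hamiltonian cycle\<close>

lemma successively_imp_zip_rotate1:
  assumes "successively P (v # vs)" "P (last (v # vs)) v"
  shows "\<forall>(a, b) \<in> set (zip (v # vs) (rotate1 (v # vs))). P a b"
proof -
  have "\<forall>(a, b) \<in> set (zip (u # vs) (vs @ [z])). P a b" if "successively P (u # vs)" "P (last (u # vs)) z" for u z
    using that by (induction vs arbitrary: u) (auto split: if_splits)
  from this[OF assms] show ?thesis by simp
qed

text \<open>A Hamiltonian path of the first piece between the ends 0 and 35 of its two forced outer
  edges. Shifted by 49, it also traverses the second piece.\<close>

definition cap_path :: "nat list" where
  "cap_path =
    [0, 4, 1, 5, 3, 6, 2, 7, 11, 8, 12, 10, 13, 9, 14, 18, 15, 19, 16, 20, 17, 42, 46, 44, 47, 45, 48, 43,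
     24, 25, 22, 26, 23, 27, 21, 30, 32, 29, 33, 31, 34, 28, 37, 39, 36, 40, 38, 41, 35]"

text \<open>The strip is split into two tracks: residues 1 and 2 modulo 4 on the way up, residues 3
  and 0 on the way down, with jumps of 5 between consecutive pairs.\<close>

primrec up_path :: "nat \<Rightarrow> nat list" where
  "up_path 0 = [102, 101]"
| "up_path (Suc k) = up_path k @ [4 * k + 106, 4 * k + 105]"

primrec down_path :: "nat \<Rightarrow> nat list" where
  "down_path 0 = [99, 100]"
| "down_path (Suc k) = [4 * k + 103, 4 * k + 104] @ down_path k"

definition cycle_path :: "nat \<Rightarrow> nat list" where
  "cycle_path k = 98 # map ((+) 49) (rev cap_path) @ up_path k @ down_path k @ cap_path"

lemma set_cap_path: "set cap_path = {..<49}" "distinct cap_path" "length cap_path = 49"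
proof -
  show d: "distinct cap_path" "length cap_path = 49" by (simp_all add: cap_path_def)
  have "set cap_path \<subseteq> {..<49}" by (simp add: cap_path_def)
  moreover have "card (set cap_path) = 49" using d by (simp add: distinct_card)
  ultimately show "set cap_path = {..<49}" by (intro card_subset_eq) simp_all
qed

lemma up_path:
  "set (up_path k) = (\<Union>i\<le>k. {4 * i + 101, 4 * i + 102})"
  "distinct (up_path k)" "up_path k \<noteq> []" "hd (up_path k) = 102" "last (up_path k) = 101 + 4 * k"
proof -
  show s: "set (up_path k) = (\<Union>i\<le>k. {4 * i + 101, 4 * i + 102})" for k
    by (induction k) (auto simp: atMost_Suc)
  show "distinct (up_path k)"
  proof (induction k)
    case (Suc k)
    have "4 * k + 106 \<notin> set (up_path k)" "4 * k + 105 \<notin> set (up_path k)" unfolding s by auto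
    then show ?case using Suc by simp
  qed simp
  show "up_path k \<noteq> []" for k by (cases k) auto
  then show "hd (up_path k) = 102" by (induction k) (auto simp: hd_append)
  show "last (up_path k) = 101 + 4 * k" by (cases k) auto
qed

lemma down_path:
  "set (down_path k) = (\<Union>i\<le>k. {4 * i + 99, 4 * i + 100})"
  "distinct (down_path k)" "down_path k \<noteq> []" "hd (down_path k) = 99 + 4 * k" "last (down_path k) = 100"
proof -
  show s: "set (down_path k) = (\<Union>i\<le>k. {4 * i + 99, 4 * i + 100})" for k
    by (induction k) (auto simp: atMost_Suc)
  show "distinct (down_path k)"
  proof (induction k)
    case (Suc k)
    have "4 * k + 103 \<notin> set (down_path k)" "4 * k + 104 \<notin> set (down_path k)" unfolding s by auto
    then show ?case using Suc by simp
  qed simp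
  show ne: "down_path k \<noteq> []" for k by (cases k) auto
  show "hd (down_path k) = 99 + 4 * k" by (cases k) auto
  show "last (down_path k) = 100" by (induction k) (auto simp: ne)
qed

lemma cycle_path:
  "set (cycle_path k) = {..102 + 4 * k}" "distinct (cycle_path k)"
proof -
  have Y: "(+) 49 ` {..<49::nat} = {49..<98}"
    by (simp add: lessThan_atLeast0 del: atLeast0LessThan)
  have "{..102 + 4 * k} = {..<49} \<union> {49..<98} \<union> {98} \<union> {99..102 + 4 * k}" by auto
  moreover have strip: "{99..102 + 4 * k} = set (up_path k) \<union> set (down_path k)"
  proof (induction k)
    case (Suc k)
    have "{99..102 + 4 * Suc k} = {99..102 + 4 * k} \<union> {4 * k + 103, 4 * k + 104, 4 * k + 105, 4 * k + 106}"
      by auto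
    then show ?case using Suc by auto
  qed auto
  ultimately show "set (cycle_path k) = {..102 + 4 * k}"
    by (auto simp: cycle_path_def set_cap_path Y)
  have "set (up_path k) \<inter> set (down_path k) = {}" unfolding up_path down_path by auto presburger+
  moreover have "set (up_path k) \<union> set (down_path k) \<subseteq> {99..}" unfolding strip[symmetric] by auto
  moreover have "distinct (map ((+) 49) (rev cap_path))" by (simp add: distinct_map set_cap_path)
  ultimately show "distinct (cycle_path k)"
    unfolding cycle_path_def by (auto simp: set_cap_path Y up_path(2) down_path(2))
qed

lemma successively_strip_paths:
  assumes "113 \<le> N" "102 + 4 * k \<le> N"
  shows "successively (\<lambda>a b. (a, b) \<in> parcs (chain_graph N)) (up_path k)"
    "successively (\<lambda>a b. (a, b) \<in> parcs (chain_graph N)) (down_path k)"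
  using assms(2)
proof (induction k)
  case 0
  {
    case 1
    show ?case using assms(1) by (simp add: nbrs_simps)
  next
    case 2
    show ?case using assms(1) by (simp add: nbrs_simps)
  }
next
  case (Suc k)
  have N: "108 \<le> N" using assms(1) by simp
  {
    case 1
    then show ?case using Suc.IH(1) up_path(3,5)
      by (simp add: successively_append_iff nbrs_strip_iff[OF N])
  next
    case 2
    then show ?case using Suc.IH(2) down_path(3,4)
      by (simp add: successively_append_iff successively_Cons nbrs_strip_iff[OF N])
  }
qed

lemma hamiltonian_cycles_graph_nonempty:
  assumes "113 \<le> N" "N = 102 + 4 * k"
  shows "hamiltonian_cycles (chain_graph N) \<noteq> {}"
proof -
  let ?P = "\<lambda>a b. (a, b) \<in> parcs (chain_graph N)"
  have N: "108 \<le> N" using assms(1) by simp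
  have c: "successively ?P cap_path"
    using assms(1) by (simp add: cap_path_def nbrs_simps)
  have d: "successively ?P (map ((+) 49) (rev cap_path))"
    using assms(1) by (simp add: cap_path_def nbrs_simps)
  have hl: "hd cap_path = 0" "last cap_path = 35" "cap_path \<noteq> []" by (simp_all add: cap_path_def)
  have "?P 98 84" "?P 49 102" "?P 100 0" "?P 35 98" using assms(1) by (simp_all add: nbrs_simps)
  \<comment> \<open>The turn at the right end uses the closing edge between \<open>N - 1\<close> and
    \<open>N - 3\<close>; this is why \<open>N\<close> has the form
    \<open>102 + 4 * k\<close>.\<close>
  moreover have "?P (101 + 4 * k) (99 + 4 * k)"
    using assms nbrs_strip_iff[of "102 + 4 * k" "99 + 4 * k" "101 + 4 * k"] by simp
  ultimately have "successively ?P (cycle_path k)"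
    using c d hl successively_strip_paths[of N k] assms up_path(3-5)[of k] down_path(3-5)[of k]
    by (simp add: cycle_path_def successively_append_iff successively_Cons hd_append hd_map hd_rev last_map last_rev)
  moreover have "?P (last (cycle_path k)) 98"
    using \<open>?P 35 98\<close> hl by (simp add: cycle_path_def)
  ultimately have "set (zip (cycle_path k) (rotate1 (cycle_path k))) \<subseteq> parcs (chain_graph N)"
    using successively_imp_zip_rotate1[of ?P 98 "tl (cycle_path k)"] by (auto simp: cycle_path_def)
  moreover have "3 \<le> length (cycle_path k)" by (simp add: cycle_path_def set_cap_path)
  ultimately have "(\<lambda>(u, v). {u, v}) ` set (zip (cycle_path k) (rotate1 (cycle_path k)))
      \<in> hamiltonian_cycles (chain_graph N)"
    using cycle_path assms(2) by (intro hamiltonian_cyclesI) simp_all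
  then show ?thesis by blast
qed

section \<open>Pigeonhole over an infinite family of graphs of distinct orders\<close>

lemma digraph_iso_card: "digraph_iso G H \<Longrightarrow> card (verts G) = card (verts H)"
  by (auto simp: digraph_iso_def pre_digraph.digraph_isomorphism_def verts_app_iso card_image)

theorem mainTheorem1:
  shows "\<exists>c::nat. c > 0 \<and>
    (\<exists>\<G> :: nat pair_pre_digraph set.
       infinite \<G> \<and>
       pairwise (\<lambda>G H. \<not> digraph_iso (with_proj G) (with_proj H)) \<G> \<and>
       (\<forall>G \<in> \<G>. pair_graph G \<and> regular 4 G \<and> vertex_connected 4 G \<and>
          card (hamiltonian_cycles G) = c))"
proof -
  define \<Gamma> where "\<Gamma> = (\<lambda>k. chain_graph (102 + 4 * k))"
  define h where "h = (\<lambda>k. card (hamiltonian_cycles (\<Gamma> k)))"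
  \<comment> \<open>From \<open>k = 3\<close> on, \<open>102 + 4 * k\<close> is at least
    113.\<close>
  have "h ` {3..} \<subseteq> {..card (Pow (Pow {..103::nat}))}"
  proof (rule image_subsetI)
    fix k :: nat assume "k \<in> {3..}"
    then show "h k \<in> {..card (Pow (Pow {..103::nat}))}"
      unfolding h_def \<Gamma>_def atMost_iff by (intro card_hamiltonian_cycles_graph_le) simp
  qed
  then have "finite (h ` {3..})" by (rule finite_subset) simp
  \<comment> \<open>Finitely many values on an infinite index set: one of them, \<open>h k0\<close>,
    has an infinite fibre and serves as the constant.\<close>
  then obtain k0 where k0: "3 \<le> k0" "infinite {k \<in> {3..}. h k = h k0}"
    using pigeonhole_infinite[of "{3..}" h] infinite_Ici by auto
  define K where "K = {k \<in> {3..}. h k = h k0}"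
  have iso: "k = l" if "digraph_iso (with_proj (\<Gamma> k)) (with_proj (\<Gamma> l))" for k l
    using digraph_iso_card[OF that] by (simp add: \<Gamma>_def)
  have "inj_on \<Gamma> K"
  proof (rule inj_onI)
    fix k l assume "\<Gamma> k = \<Gamma> l"
    then have "pverts (\<Gamma> k) = pverts (\<Gamma> l)" by simp
    then show "k = l" by (simp add: \<Gamma>_def)
  qed
  then have "infinite (\<Gamma> ` K)" using k0(2) by (simp add: finite_image_iff K_def)
  moreover have "pairwise (\<lambda>G H. \<not> digraph_iso (with_proj G) (with_proj H)) (\<Gamma> ` K)"
    unfolding pairwise_def using iso by blast
  moreover have "pair_graph G \<and> regular 4 G \<and> vertex_connected 4 G \<and> card (hamiltonian_cycles G) = h k0"
    if "G \<in> \<Gamma> ` K" for G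
    using that by (auto simp: \<Gamma>_def K_def h_def pair_graph_graph regular_graph vertex_connected_graph)
  moreover have "h k0 > 0"
    unfolding h_def \<Gamma>_def
    using k0(1) card_hamiltonian_cycles_graph_le(1) hamiltonian_cycles_graph_nonempty[OF _ refl]
    by (simp add: card_gt_0_iff)
  ultimately show ?thesis by blast
qed

end
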